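(* There exists a universal constant $C>0$ (independent of $n$, $H$ and $I$) such that the following holds. Let $H$ be a real symmetric $n\times n$ matrix, let $I\subset\mathbb{R}$ be such that $N(I)\ge1$, and let $u\in\mathbb{S}_I$ be a random vector with law $\mathbb{P}_I$. Then: (i) For any $q\in[2,+\infty)$ and any $\Lambda\ge1$, $$\mathbb{P}_I\left(\|u\|_{L^q}\ge C\Lambda\sqrt{q}\,N(I)^{\frac1q-\frac12}\right)\le4\exp\left(-\frac18C^2\Lambda^2q\,N(I)^{\frac2q}\right).$$ (ii) For any $\Lambda\ge1$, $$\mathbb{P}_I\left(\|u\|_{L^\infty}\ge C'\Lambda\left(\frac{\log(N(I))}{N(I)}\right)^{\frac12}\right)\le4N(I)^{-\frac18C'^2\Lambda^2},$$ where $C'=Ce$.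
   Context: For a real symmetric $n\times n$ matrix $H$ and $I\subset\mathbb{R}$, $N(I)$ is the number of eigenvalues of $H$ in $I$, counted with multiplicity. Let $(\psi_{\lambda_k})_{k\in[n]}$ be an orthonormal basis of $\mathbb{R}^n$ of eigenvectors of $H$ with associated eigenvalues $\lambda_k$. Set $E_I=\{\sum_{k:\lambda_k\in I}z_k\psi_{\lambda_k}: z_k\in\mathbb{R}\}\subset\mathbb{R}^n$ with the Euclidean structure of $\mathbb{R}^n$, $\mathbb{S}_I$ its unit sphere, and $\mathbb{P}_I$ the uniform probability measure on $\mathbb{S}_I$. For $u\in\mathbb{R}^n$, $\|u\|_{L^q}=(\sum_i|u_i|^q)^{1/q}$ and $\|u\|_{L^\infty}=\max_i|u_i|$. *)

theory Defs
  imports "HOL-Probability.Probability_Measure" "Jordan_Normal_Form.Char_Poly"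
begin

(* The dimension n is quantified inside the statement, below the constant C, so vectors and
   matrices are those of Jordan_Normal_Form, whose dimension is a term. *)

hide_const (open) Finite_Cartesian_Product.vec Finite_Cartesian_Product.vec.vec_nth
hide_type (open) Finite_Cartesian_Product.vec
no_notation Finite_Cartesian_Product.vec.vec_nth (infixl "$" 90)
no_notation inner (infix "\<bullet>" 70)

definition eig_count :: "real mat \<Rightarrow> real set \<Rightarrow> nat" where
  "eig_count H I = (\<Sum>x\<in>{x. eigenvalue H x \<and> x \<in> I}. order x (char_poly H))"

definition orthonormal_eigenbasis ::
    "nat \<Rightarrow> real mat \<Rightarrow> (nat \<Rightarrow> real vec) \<Rightarrow> (nat \<Rightarrow> real) \<Rightarrow> bool" where
  "orthonormal_eigenbasis n H \<psi> ev \<longleftrightarrow>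
     (\<forall>k<n. \<psi> k \<in> carrier_vec n) \<and>
     (\<forall>j<n. \<forall>k<n. \<psi> j \<bullet> \<psi> k = (if j = k then 1 else 0)) \<and>
     (\<forall>k<n. eigenvector H (\<psi> k) (ev k))"

definition eig_indices :: "nat \<Rightarrow> (nat \<Rightarrow> real) \<Rightarrow> real set \<Rightarrow> nat set" where
  "eig_indices n ev I = {k. k < n \<and> ev k \<in> I}"

definition eig_comb :: "nat \<Rightarrow> (nat \<Rightarrow> real vec) \<Rightarrow> nat set \<Rightarrow> (nat \<Rightarrow> real) \<Rightarrow> real vec" where
  "eig_comb n \<psi> K z = finsum_vec TYPE(real) n (\<lambda>k. z k \<cdot>\<^sub>v \<psi> k) K"

definition spectral_space ::
    "nat \<Rightarrow> (nat \<Rightarrow> real vec) \<Rightarrow> (nat \<Rightarrow> real) \<Rightarrow> real set \<Rightarrow> real vec set" where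
  "spectral_space n \<psi> ev I = {eig_comb n \<psi> (eig_indices n ev I) z |z. True}"

definition spectral_sphere ::
    "nat \<Rightarrow> (nat \<Rightarrow> real vec) \<Rightarrow> (nat \<Rightarrow> real) \<Rightarrow> real set \<Rightarrow> real vec set" where
  "spectral_sphere n \<psi> ev I = {u \<in> spectral_space n \<psi> ev I. sqrt (u \<bullet> u) = 1}"

(* Borel sigma-algebra of R^n, transported to the type of vectors (which carries no topology)
   along the coordinates. *)
definition borel_vec :: "nat \<Rightarrow> real vec measure" where
  "borel_vec n =
     vimage_algebra (carrier_vec n) (\<lambda>v. \<lambda>i\<in>{..<n}. v $ i) (\<Pi>\<^sub>M i\<in>{..<n}. borel)"

definition coord_norm :: "nat set \<Rightarrow> (nat \<Rightarrow> real) \<Rightarrow> real" where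
  "coord_norm K z = sqrt (\<Sum>k\<in>K. (z k)\<^sup>2)"

definition punctured_ball :: "nat set \<Rightarrow> (nat \<Rightarrow> real) set" where
  "punctured_ball K = {z \<in> K \<rightarrow>\<^sub>E UNIV. 0 < coord_norm K z \<and> coord_norm K z \<le> 1}"

definition uniform_ball :: "nat set \<Rightarrow> (nat \<Rightarrow> real) measure" where
  "uniform_ball K =
     restrict_space (uniform_measure (\<Pi>\<^sub>M k\<in>K. lborel) (punctured_ball K)) (punctured_ball K)"

(* The uniform probability measure on the unit sphere of E_I, as normalised cone measure: a Borel
   set A of the sphere has mass vol {x : 0 < |x| <= 1, x/|x| in A} / vol {x : |x| <= 1}, with the
   volume of E_I taken in the coordinates of the orthonormal basis (psi_k), ev k in I.  Volume being
   invariant under orthogonal maps, so is this measure, and it does not depend on the choice of the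
   orthonormal basis of E_I.  The origin is removed only to make the projection total. *)
definition sphere_uniform ::
    "nat \<Rightarrow> (nat \<Rightarrow> real vec) \<Rightarrow> (nat \<Rightarrow> real) \<Rightarrow> real set \<Rightarrow> real vec measure" where
  "sphere_uniform n \<psi> ev I =
     (let K = eig_indices n ev I in
      distr (uniform_ball K) (restrict_space (borel_vec n) (spectral_sphere n \<psi> ev I))
        (\<lambda>z. eig_comb n \<psi> K (\<lambda>k. z k / coord_norm K z)))"

definition Lq_norm :: "real \<Rightarrow> real vec \<Rightarrow> real" where
  "Lq_norm q u = (\<Sum>i<dim_vec u. \<bar>u $ i\<bar> powr q) powr (1 / q)"

definition Linf_norm :: "real vec \<Rightarrow> real" where
  "Linf_norm u = (MAX i\<in>{..<dim_vec u}. \<bar>u $ i\<bar>)"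


(* sphere_uniform is a probability measure on the Borel sets of the sphere, and the two norms are
   Borel, so the probabilities in the theorem are not artefacts of non-measurability. *)

lemma finite_eig_indices [simp]: "finite (eig_indices n ev I)"
  by (simp add: eig_indices_def)

lemma punctured_ball_sets:
  assumes "finite K"
  shows "punctured_ball K \<in> sets (\<Pi>\<^sub>M k\<in>K. (lborel :: real measure))"
proof -
  let ?M = "\<Pi>\<^sub>M k\<in>K. (lborel :: real measure)"
  have [measurable]: "(\<lambda>z. coord_norm K z) \<in> borel_measurable ?M"
    unfolding coord_norm_def by measurable
  have "punctured_ball K = {z \<in> space ?M. 0 < coord_norm K z \<and> coord_norm K z \<le> 1}"
    by (auto simp: punctured_ball_def space_PiM)
  also have "\<dots> \<in> sets ?M" by measurable
  finally show ?thesis .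
qed

lemma emeasure_punctured_ball:
  assumes fin: "finite K" and ne: "K \<noteq> {}"
  shows "emeasure (\<Pi>\<^sub>M k\<in>K. (lborel :: real measure)) (punctured_ball K) \<noteq> 0"
    and "emeasure (\<Pi>\<^sub>M k\<in>K. (lborel :: real measure)) (punctured_ball K) \<noteq> \<infinity>"
proof -
  interpret product_sigma_finite "\<lambda>_::nat. (lborel :: real measure)"
    by standard
  let ?M = "\<Pi>\<^sub>M k\<in>K. (lborel :: real measure)"
  define m where "m = real (card K)"
  have m: "m \<ge> 1" using fin ne by (simp add: m_def Suc_le_eq card_gt_0_iff)
  have "(\<Pi>\<^sub>E k\<in>K. {1 / (2 * m)..1 / m}) \<subseteq> punctured_ball K"
  proof
    fix z assume z: "z \<in> (\<Pi>\<^sub>E k\<in>K. {1 / (2 * m)..1 / m})"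
    have pos: "0 < z k" if "k \<in> K" for k
    proof -
      have "z k \<ge> 1 / (2 * m)" using z that by (auto simp: PiE_def Pi_def)
      moreover have "1 / (2 * m) > 0" using m by simp
      ultimately show ?thesis by linarith
    qed
    have le: "(z k)\<^sup>2 \<le> 1 / m" if "k \<in> K" for k
    proof -
      have a: "z k \<le> 1 / m" using z that by (auto simp: PiE_def Pi_def)
      have b: "1 / m \<le> 1" using m by simp
      have "z k * z k \<le> 1 * (1 / m)"
        by (rule mult_mono) (use a b pos[OF that] in linarith)+
      then show ?thesis by (simp add: power2_eq_square)
    qed
    have "(\<Sum>k\<in>K. (z k)\<^sup>2) \<le> (\<Sum>k\<in>K. 1 / m)" by (rule sum_mono) (rule le)
    also have "\<dots> = 1" using m by (simp add: m_def[symmetric])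
    finally have "(\<Sum>k\<in>K. (z k)\<^sup>2) \<le> 1" .
    moreover have "0 < (\<Sum>k\<in>K. (z k)\<^sup>2)"
      by (rule sum_pos[OF fin ne]) (rule zero_less_power[OF pos])
    ultimately show "z \<in> punctured_ball K"
      using z by (auto simp: punctured_ball_def coord_norm_def PiE_def)
  qed
  then have "emeasure ?M (\<Pi>\<^sub>E k\<in>K. {1 / (2 * m)..1 / m}) \<le> emeasure ?M (punctured_ball K)"
    by (intro emeasure_mono punctured_ball_sets fin)
  moreover have "emeasure ?M (\<Pi>\<^sub>E k\<in>K. {1 / (2 * m)..1 / m}) =
      (\<Prod>k\<in>K. emeasure lborel {1 / (2 * m)..1 / m})"
    by (rule emeasure_PiM) (use fin in auto)
  moreover have "(\<Prod>k\<in>K. emeasure lborel {1 / (2 * m)..1 / m}) \<noteq> (0 :: ennreal)"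
    using m fin by (auto simp: prod_zero_iff field_simps ennreal_eq_0_iff)
  ultimately show "emeasure ?M (punctured_ball K) \<noteq> 0" by auto
  have "punctured_ball K \<subseteq> (\<Pi>\<^sub>E k\<in>K. {-1..1})"
  proof
    fix z assume z: "z \<in> punctured_ball K"
    have "\<bar>z k\<bar> \<le> 1" if "k \<in> K" for k
    proof -
      have "(z k)\<^sup>2 \<le> (\<Sum>k\<in>K. (z k)\<^sup>2)" using that fin by (intro member_le_sum) auto
      also have "\<dots> \<le> 1" using z by (simp add: punctured_ball_def coord_norm_def)
      finally show ?thesis by (simp add: abs_square_le_1)
    qed
    then have "z k \<in> {-1..1}" if "k \<in> K" for k using that by (simp add: abs_le_iff minus_le_iff)
    then show "z \<in> (\<Pi>\<^sub>E k\<in>K. {-1..1})"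
      using z unfolding punctured_ball_def PiE_def Pi_def by blast
  qed
  then have "emeasure ?M (punctured_ball K) \<le> emeasure ?M (\<Pi>\<^sub>E k\<in>K. {-1..1})"
    by (intro emeasure_mono sets_PiM_I_finite fin) auto
  also have "\<dots> = (\<Prod>k\<in>K. emeasure lborel {-1..1::real})"
    by (rule emeasure_PiM) (use fin in auto)
  also have "\<dots> = 2 ^ card K" by simp
  also have "\<dots> < \<infinity>" by (simp add: power_less_top_ennreal)
  finally show "emeasure ?M (punctured_ball K) \<noteq> \<infinity>" by auto
qed

lemma space_uniform_ball: "finite K \<Longrightarrow> space (uniform_ball K) = punctured_ball K"
  by (auto simp: uniform_ball_def space_restrict_space space_PiM punctured_ball_def)

lemma prob_space_uniform_ball:
  assumes fin: "finite K" and ne: "K \<noteq> {}"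
  shows "prob_space (uniform_ball K)"
proof -
  note e = emeasure_punctured_ball[OF fin ne] and s = punctured_ball_sets[OF fin]
  have "emeasure (uniform_measure (\<Pi>\<^sub>M k\<in>K. (lborel :: real measure)) (punctured_ball K))
      (punctured_ball K) = 1"
    using e s by (simp add: emeasure_uniform_measure ennreal_divide_self top.not_eq_extremum)
  then show ?thesis
    unfolding uniform_ball_def
    by (intro prob_space_restrict_space) (use s in auto)
qed

lemma space_borel_vec: "space (borel_vec n) = carrier_vec n"
  by (simp add: borel_vec_def)

lemma measurable_borel_vecI:
  assumes "\<And>x. x \<in> space M \<Longrightarrow> f x \<in> carrier_vec n"
    and "\<And>i. i < n \<Longrightarrow> (\<lambda>x. f x $ i) \<in> borel_measurable M"
  shows "f \<in> measurable M (borel_vec n)"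
  unfolding borel_vec_def
  by (rule measurable_vimage_algebra2) (use assms in \<open>auto intro!: measurable_restrict\<close>)

lemma measurable_vec_index:
  assumes "i < n"
  shows "(\<lambda>v. v $ i) \<in> borel_measurable (borel_vec n)"
proof -
  have "(\<lambda>v. (\<lambda>i\<in>{..<n}. v $ i) i) \<in> borel_measurable (borel_vec n)"
    unfolding borel_vec_def
    by (rule measurable_compose[OF measurable_vimage_algebra1 measurable_component_singleton])
       (use assms in \<open>simp_all add: space_PiM Pi_def PiE_def extensional_def\<close>)
  then show ?thesis using assms by simp
qed

lemma eig_comb_carrier:
  assumes "\<And>k. k \<in> K \<Longrightarrow> \<psi> k \<in> carrier_vec n"
  shows "eig_comb n \<psi> K z \<in> carrier_vec n"
  unfolding eig_comb_def by (rule finsum_vec_closed) (use assms in auto)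

lemma eig_comb_index:
  assumes "finite K" "\<And>k. k \<in> K \<Longrightarrow> \<psi> k \<in> carrier_vec n" "i < n"
  shows "eig_comb n \<psi> K z $ i = (\<Sum>k\<in>K. z k * \<psi> k $ i)"
proof -
  have "eig_comb n \<psi> K z $ i = (\<Sum>k\<in>K. (z k \<cdot>\<^sub>v \<psi> k) $ i)"
    unfolding eig_comb_def by (rule index_finsum_vec) (use assms in auto)
  also have "\<dots> = (\<Sum>k\<in>K. z k * \<psi> k $ i)"
    by (rule sum.cong) (use assms in \<open>auto simp: carrier_vecD[OF assms(2)]\<close>)
  finally show ?thesis .
qed

lemma eig_comb_norm:
  assumes fin: "finite K" and car: "\<And>k. k \<in> K \<Longrightarrow> \<psi> k \<in> carrier_vec n"
    and orth: "\<And>j k. j \<in> K \<Longrightarrow> k \<in> K \<Longrightarrow> \<psi> j \<bullet> \<psi> k = (if j = k then 1 else 0)"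
  shows "eig_comb n \<psi> K z \<bullet> eig_comb n \<psi> K z = (\<Sum>k\<in>K. (z k)\<^sup>2)"
proof -
  have c: "eig_comb n \<psi> K z \<in> carrier_vec n" using car by (rule eig_comb_carrier)
  have "eig_comb n \<psi> K z \<bullet> eig_comb n \<psi> K z =
      (\<Sum>i=0..<n. (\<Sum>j\<in>K. z j * \<psi> j $ i) * (\<Sum>k\<in>K. z k * \<psi> k $ i))"
    unfolding scalar_prod_def carrier_vecD[OF c]
    by (rule sum.cong) (simp_all add: eig_comb_index[OF fin car])
  also have "\<dots> = (\<Sum>i=0..<n. \<Sum>j\<in>K. \<Sum>k\<in>K. z j * z k * (\<psi> j $ i * \<psi> k $ i))"
    by (simp add: sum_product mult_ac)
  also have "\<dots> = (\<Sum>j\<in>K. \<Sum>k\<in>K. \<Sum>i=0..<n. z j * z k * (\<psi> j $ i * \<psi> k $ i))"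
    by (subst sum.swap, rule sum.cong[OF refl], rule sum.swap)
  also have "\<dots> = (\<Sum>j\<in>K. \<Sum>k\<in>K. z j * z k * (\<psi> j \<bullet> \<psi> k))"
    by (intro sum.cong refl)
       (simp add: scalar_prod_def carrier_vecD[OF car] sum_distrib_left)
  also have "\<dots> = (\<Sum>j\<in>K. \<Sum>k\<in>K. if j = k then z j * z k else 0)"
    by (intro sum.cong refl) (simp add: orth)
  also have "\<dots> = (\<Sum>k\<in>K. (z k)\<^sup>2)"
    using fin by (simp add: power2_eq_square)
  finally show ?thesis .
qed

lemma sphere_subset_carrier:
  assumes "orthonormal_eigenbasis n H \<psi> ev"
  shows "spectral_sphere n \<psi> ev I \<subseteq> carrier_vec n"
  using assms
  by (auto simp: spectral_sphere_def spectral_space_def orthonormal_eigenbasis_def eig_indices_def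
      intro!: eig_comb_carrier)

lemma space_sphere_uniform:
  assumes "orthonormal_eigenbasis n H \<psi> ev"
  shows "space (sphere_uniform n \<psi> ev I) = spectral_sphere n \<psi> ev I"
  using sphere_subset_carrier[OF assms]
  by (auto simp: sphere_uniform_def Let_def space_restrict_space space_borel_vec)

lemma sphere_projection_measurable:
  assumes ob: "orthonormal_eigenbasis n H \<psi> ev" and K: "K = eig_indices n ev I"
  shows "(\<lambda>z. eig_comb n \<psi> K (\<lambda>k. z k / coord_norm K z))
    \<in> measurable (uniform_ball K) (restrict_space (borel_vec n) (spectral_sphere n \<psi> ev I))"
proof (rule measurable_restrict_space2)
  have fin: "finite K" using K by simp
  have car: "\<psi> k \<in> carrier_vec n" if "k \<in> K" for k
    using ob that K by (auto simp: orthonormal_eigenbasis_def eig_indices_def)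
  have orth: "\<psi> j \<bullet> \<psi> k = (if j = k then 1 else 0)" if "j \<in> K" "k \<in> K" for j k
    using ob that K by (auto simp: orthonormal_eigenbasis_def eig_indices_def)
  show "(\<lambda>z. eig_comb n \<psi> K (\<lambda>k. z k / coord_norm K z))
      \<in> space (uniform_ball K) \<rightarrow> spectral_sphere n \<psi> ev I"
  proof
    fix z assume "z \<in> space (uniform_ball K)"
    then have z: "0 < coord_norm K z" by (simp add: space_uniform_ball[OF fin] punctured_ball_def)
    have "(\<Sum>k\<in>K. (z k / coord_norm K z)\<^sup>2) = (\<Sum>k\<in>K. (z k)\<^sup>2) / (coord_norm K z)\<^sup>2"
      by (simp add: power_divide sum_divide_distrib)
    also have "(coord_norm K z)\<^sup>2 = (\<Sum>k\<in>K. (z k)\<^sup>2)"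
      by (simp add: coord_norm_def sum_nonneg)
    finally have "(\<Sum>k\<in>K. (z k / coord_norm K z)\<^sup>2) = 1"
      using z by (simp add: coord_norm_def)
    then show "eig_comb n \<psi> K (\<lambda>k. z k / coord_norm K z) \<in> spectral_sphere n \<psi> ev I"
      using eig_comb_norm[OF fin car orth, of "\<lambda>k. z k / coord_norm K z"]
        \<open>(\<Sum>k\<in>K. (z k / coord_norm K z)\<^sup>2) = 1\<close>
      unfolding spectral_sphere_def spectral_space_def K[symmetric]
      by (intro CollectI conjI exI[of _ "\<lambda>k. z k / coord_norm K z"]) simp_all
  qed
  show "(\<lambda>z. eig_comb n \<psi> K (\<lambda>k. z k / coord_norm K z)) \<in> measurable (uniform_ball K) (borel_vec n)"
  proof (rule measurable_borel_vecI)
    show "eig_comb n \<psi> K (\<lambda>k. z k / coord_norm K z) \<in> carrier_vec n" for z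
      by (rule eig_comb_carrier) (rule car)
  next
    fix i assume i: "i < n"
    have "(\<lambda>z. \<Sum>k\<in>K. z k / coord_norm K z * \<psi> k $ i)
        \<in> borel_measurable (\<Pi>\<^sub>M k\<in>K. (lborel :: real measure))"
      unfolding coord_norm_def by measurable
    moreover have "(\<lambda>z. eig_comb n \<psi> K (\<lambda>k. z k / coord_norm K z) $ i) =
        (\<lambda>z. \<Sum>k\<in>K. z k / coord_norm K z * \<psi> k $ i)"
      by (rule ext) (rule eig_comb_index[OF fin car i])
    ultimately show "(\<lambda>z. eig_comb n \<psi> K (\<lambda>k. z k / coord_norm K z) $ i)
        \<in> borel_measurable (uniform_ball K)"
      unfolding uniform_ball_def
      by (intro measurable_restrict_space1)
         (simp add: measurable_def sets_uniform_measure space_uniform_measure)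
  qed
qed

lemma prob_space_sphere_uniform:
  assumes "orthonormal_eigenbasis n H \<psi> ev" and "eig_indices n ev I \<noteq> {}"
  shows "prob_space (sphere_uniform n \<psi> ev I)"
  unfolding sphere_uniform_def Let_def
  by (intro prob_space.prob_space_distr prob_space_uniform_ball
      sphere_projection_measurable[OF assms(1)]) (use assms in auto)

lemma Lq_norm_measurable: "Lq_norm q \<in> borel_measurable (borel_vec n)"
proof -
  have [measurable]: "\<And>i. i < n \<Longrightarrow> (\<lambda>v. v $ i) \<in> borel_measurable (borel_vec n)"
    by (rule measurable_vec_index)
  have "(\<lambda>u. (\<Sum>i<n. \<bar>u $ i\<bar> powr q) powr (1 / q)) \<in> borel_measurable (borel_vec n)"
    by measurable
  then show ?thesis
    by (rule measurable_cong[THEN iffD1, rotated]) (auto simp: space_borel_vec Lq_norm_def)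
qed

lemma Linf_norm_measurable: "Linf_norm \<in> borel_measurable (borel_vec n)"
proof -
  have "(\<lambda>u. Max ((\<lambda>i. \<bar>u $ i\<bar>) ` {..<n})) \<in> borel_measurable (borel_vec n)"
    by (rule borel_measurable_Max) (auto intro: borel_measurable_abs measurable_vec_index)
  then show ?thesis
    by (rule measurable_cong[THEN iffD1, rotated]) (auto simp: space_borel_vec Linf_norm_def)
qed

end

theory Submission
  imports "HOL-Probability.Distributions" Defs
begin

text \<open>
  Write a vector of the unit sphere of \<open>E_I\<close> as \<open>u = x / |x|\<close> with \<open>x\<close> a standard Gaussian vector of
  \<open>E_I\<close>; the direction is independent of \<open>|x|\<close>, and \<open>|x|\<close> exceeds \<open>(3 N / 4)\<^sup>1\<^sup>/\<^sup>2\<close> with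
  probability bounded below.  Each coordinate of \<open>x\<close> is Gaussian with variance \<open>a i \<le> 1\<close> and the
  \<open>a i\<close> sum to \<open>N\<close>, so that a moment computation bounds the median of the \<open>L\<^sup>q\<close> norm of \<open>x\<close> by
  \<open>2 q\<^sup>1\<^sup>/\<^sup>2 N\<^sup>1\<^sup>/\<^sup>q\<close>.  For \<open>q \<ge> 2\<close> this norm is 1-Lipschitz, hence Gaussian concentration with the
  exponent \<open>d\<^sup>2 / 4\<close> provided by the Prekopa--Leindler inequality gives (i), with room to spare over
  the exponent \<open>1 / 8\<close> once \<open>C\<close> is large.  Part (ii) is (i) with \<open>q = ln N\<close>; when \<open>ln N < 2\<close> the
  event is empty or the bound is trivial.
\<close>

section \<open>The Prekopa--Leindler inequality with a Gaussian middle function\<close>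

text \<open>Levy's isoperimetric inequality would act on the sphere directly; a Gaussian vector
  replaces it by a statement on product measures, which tensorises from the line. Since
  \<open>sphere_uniform\<close> is a normalised Lebesgue cone measure, no polar coordinates are
  needed to reach the Gaussian: its density is a superposition of indicators of centred balls, and
  every such ball gives a cone the same share of its volume.

  Constants, with \<open>N = card K\<close>, threshold \<open>s\<close> and
  \<open>S = s * sqrt N\<close>: the bound in (i) is 4 exp(-S^2/8). If |u|_q >= s and |x| > r =
  sqrt(3N/4), then |x|_q >= s r, which exceeds the median bound
  \<open>M = 2 * sqrt q * N powr (1 / q)\<close> by d = s r - M. The choice C = 60, which is 30
  times the factor 2 in M, gives S >= 30 M >= 60 and hence d >= 4S/5. The concentration exponent
  d^2/4 >= 4S^2/25 then beats S^2/8 by 7S^2/200, which pays for the prefactor 2 * 128 = 4 * 64 left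
  by the median (2) and the radius (128).\<close>

text \<open>Layer-cake formula: Tonelli on the region under the graph.\<close>

lemma nn_integral_superlevel_sets:
  fixes f :: "real \<Rightarrow> real"
  assumes [measurable]: "f \<in> borel_measurable borel" and nonneg: "\<And>x. 0 \<le> f x"
  shows "(\<integral>\<^sup>+x. ennreal (f x) \<partial>lborel) =
    (\<integral>\<^sup>+t. indicator {0<..} t * emeasure lborel {x. t < f x} \<partial>lborel)"
proof -
  have "ennreal (f x) = (\<integral>\<^sup>+t. indicator {0<..} t * indicator {x. t < f x} x \<partial>lborel)" for x
  proof -
    have "ennreal (f x) = emeasure lborel {0<..<f x}" using nonneg[of x] by simp
    also have "\<dots> = (\<integral>\<^sup>+t. indicator {0<..<f x} t \<partial>lborel)" by simp
    also have "\<dots> = (\<integral>\<^sup>+t. indicator {0<..} t * indicator {x. t < f x} x \<partial>lborel)"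
      by (intro nn_integral_cong) (auto split: split_indicator)
    finally show ?thesis .
  qed
  then have "(\<integral>\<^sup>+x. ennreal (f x) \<partial>lborel) =
      (\<integral>\<^sup>+x. (\<integral>\<^sup>+t. indicator {0<..} t * indicator {x. t < f x} x \<partial>lborel) \<partial>lborel)"
    by simp
  also have "\<dots> = (\<integral>\<^sup>+t. (\<integral>\<^sup>+x. indicator {0<..} t * indicator {x. t < f x} x \<partial>lborel) \<partial>lborel)"
    by (rule lborel_pair.Fubini') measurable
  also have "\<dots> = (\<integral>\<^sup>+t. indicator {0<..} t * emeasure lborel {x. t < f x} \<partial>lborel)"
    by (intro nn_integral_cong) (simp add: nn_integral_cmult)
  finally show ?thesis .
qed

text \<open>If the hull of X is [i, s], then Y is forced into [-r - i, r - s]; the two lengths s - i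
  and 2r - (s - i) add up to 2r.\<close>

lemma emeasure_add_le_of_abs_add_le:
  fixes X Y :: "real set"
  assumes ne: "X \<noteq> {}" "Y \<noteq> {}" and le: "\<And>x y. x \<in> X \<Longrightarrow> y \<in> Y \<Longrightarrow> \<bar>x + y\<bar> \<le> r"
  shows "emeasure lborel X + emeasure lborel Y \<le> ennreal (2 * r)"
proof -
  obtain x0 y0 where x0: "x0 \<in> X" and y0: "y0 \<in> Y" using ne by auto
  have "x \<le> r - y0" "- r - y0 \<le> x" if "x \<in> X" for x
    using le[OF that y0] by (auto simp: abs_le_iff)
  then have bX: "bdd_above X" "bdd_below X"
    unfolding bdd_above_def bdd_below_def by blast+
  let ?i = "Inf X" and ?s = "Sup X"
  have X: "X \<subseteq> {?i..?s}" using bX by (auto intro: cInf_lower cSup_upper)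
  have Y: "Y \<subseteq> {- r - ?i..r - ?s}"
  proof
    fix y assume y: "y \<in> Y"
    have "x \<le> r - y" "- r - y \<le> x" if "x \<in> X" for x
      using le[OF that y] by (auto simp: abs_le_iff)
    then have "?s \<le> r - y" "- r - y \<le> ?i"
      using ne by (auto intro: cSup_least cInf_greatest)
    then show "y \<in> {- r - ?i..r - ?s}" by auto
  qed
  have i_le_s: "?i \<le> ?s" using X x0 by auto
  have rs: "- r - ?i \<le> r - ?s" using Y y0 by auto
  have "emeasure lborel X \<le> ennreal (?s - ?i)"
    using emeasure_mono[OF X, of lborel] i_le_s by simp
  moreover have "emeasure lborel Y \<le> ennreal ((r - ?s) - (- r - ?i))"
    using emeasure_mono[OF Y, of lborel] rs by simp
  ultimately have "emeasure lborel X + emeasure lborel Y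
      \<le> ennreal (?s - ?i) + ennreal ((r - ?s) - (- r - ?i))"
    by (rule add_mono)
  also have "\<dots> = ennreal (2 * r)"
    using i_le_s rs by (subst ennreal_plus[symmetric]) (auto simp: algebra_simps)
  finally show ?thesis .
qed

lemma nn_integral_gaussian: "(\<integral>\<^sup>+x. ennreal (exp (- x\<^sup>2 / 2)) \<partial>lborel) = ennreal (sqrt (2 * pi))"
proof -
  have "(\<integral>\<^sup>+x. ennreal (exp (- x\<^sup>2 / 2)) \<partial>lborel) =
      (\<integral>\<^sup>+x. ennreal (sqrt (2 * pi)) * ennreal (std_normal_density x) \<partial>lborel)"
    by (intro nn_integral_cong) (simp add: std_normal_density_def flip: ennreal_mult)
  also have "\<dots> = ennreal (sqrt (2 * pi)) * (\<integral>\<^sup>+x. ennreal (std_normal_density x) \<partial>lborel)"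
    by (rule nn_integral_cmult) simp
  also have "(\<integral>\<^sup>+x. ennreal (std_normal_density x) \<partial>lborel) = 1"
    by (subst nn_integral_eq_integral) auto
  finally show ?thesis by simp
qed

text \<open>The Prekopa--Leindler inequality on the line with a Gaussian as third function: its superlevel
  sets are intervals, so the one-dimensional Brunn--Minkowski inequality is only needed in the
  trivial form above.\<close>
lemma prekopa_leindler_gaussian_normalised:
  fixes f g :: "real \<Rightarrow> real"
  assumes [measurable]: "f \<in> borel_measurable borel" "g \<in> borel_measurable borel"
    and f: "\<And>x. 0 \<le> f x" "\<And>x. f x \<le> 1" "\<And>t. t < 1 \<Longrightarrow> \<exists>x. t < f x"
    and g: "\<And>x. 0 \<le> g x" "\<And>x. g x \<le> 1" "\<And>t. t < 1 \<Longrightarrow> \<exists>x. t < g x"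
    and c: "c > 0"
    and fg: "\<And>x y. f x * g y \<le> (c * exp (- ((x + y) / 2)\<^sup>2 / 2))\<^sup>2"
  shows "(\<integral>\<^sup>+x. f x \<partial>lborel) + (\<integral>\<^sup>+x. g x \<partial>lborel) \<le> ennreal (2 * c * sqrt (2 * pi))"
proof -
  let ?h = "\<lambda>x::real. c * exp (- x\<^sup>2 / 2)"
  have level: "emeasure lborel {x. t < f x} + emeasure lborel {x. t < g x}
      \<le> 2 * emeasure lborel {x. t < ?h x}" if t: "0 < t" for t
  \<comment> \<open>This is what the normalisation to supremum 1 buys: at each level the two
    superlevel sets are both empty or both nonempty, so the bound for a pair of nonempty sets always
    applies.\<close>
  proof (cases "t < 1")
    case False
    then have "{x. t < f x} = {}" "{x. t < g x} = {}" using f(2) g(2) by (auto simp: not_less intro: order.trans)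
    then show ?thesis by simp
  next
    case True
    define r where "r = sqrt (2 * ln (c / t))"
    have iff: "t < ?h x \<longleftrightarrow> x\<^sup>2 < 2 * ln (c / t)" for x
    proof -
      have "t < ?h x \<longleftrightarrow> ln t < ln (?h x)" using t c by simp
      also have "ln (?h x) = ln c - x\<^sup>2 / 2" using c by (simp add: ln_mult)
      also have "ln t < ln c - x\<^sup>2 / 2 \<longleftrightarrow> x\<^sup>2 < 2 * ln (c / t)"
        using t c by (simp add: ln_div field_simps)
      finally show ?thesis .
    qed
    \<comment> \<open>The hypothesis bounds the geometric mean of \<open>f x\<close> and
      \<open>g y\<close> by the Gaussian at the midpoint, so midpoints of the two level sets lie in
      the level set of the Gaussian for the same t.\<close>
    have mid: "t < ?h ((x + y) / 2)" if "t < f x" "t < g y" for x y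
    proof -
      have "t\<^sup>2 < f x * g y" using that t by (simp add: power2_eq_square mult_strict_mono)
      also have "\<dots> \<le> (?h ((x + y) / 2))\<^sup>2" by (rule fg)
      finally show ?thesis using c by (intro power_less_imp_less_base[of t 2]) auto
    qed
    obtain x0 y0 where xy: "t < f x0" "t < g y0" using f(3)[OF True] g(3)[OF True] by auto
    have pos: "0 < 2 * ln (c / t)"
      using mid[OF xy] unfolding iff by (smt (verit) zero_le_power2)
    have E: "{x. t < ?h x} = {- r<..<r}"
    proof -
      have "x\<^sup>2 < 2 * ln (c / t) \<longleftrightarrow> \<bar>x\<bar> < r" for x
        using real_sqrt_less_iff[of "x\<^sup>2" "2 * ln (c / t)"] by (simp add: r_def)
      then have "{x. t < ?h x} = {x. \<bar>x\<bar> < r}" by (simp only: iff)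
      also have "{x. \<bar>x\<bar> < r} = {- r<..<r}" by auto
      finally show ?thesis .
    qed
    \<comment> \<open>Midpoints in (-r, r) mean sums of absolute value at most 2r, so the total
      length is at most 4r, twice the length of (-r, r).\<close>
    have "emeasure lborel {x. t < f x} + emeasure lborel {x. t < g x} \<le> ennreal (2 * (2 * r))"
    proof (rule emeasure_add_le_of_abs_add_le)
      fix x y assume "x \<in> {x. t < f x}" "y \<in> {x. t < g x}"
      then have "(x + y) / 2 \<in> {- r<..<r}" unfolding E[symmetric] using mid by simp
      then show "\<bar>x + y\<bar> \<le> 2 * r" by auto
    qed (use xy in auto)
    also have "\<dots> = 2 * emeasure lborel {x. t < ?h x}"
      unfolding E using pos by (simp add: r_def ennreal_mult flip: mult.assoc)
    finally show ?thesis .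
  qed
  have "(\<integral>\<^sup>+x. f x \<partial>lborel) + (\<integral>\<^sup>+x. g x \<partial>lborel) =
      (\<integral>\<^sup>+t. indicator {0<..} t * emeasure lborel {x. t < f x} \<partial>lborel) +
      (\<integral>\<^sup>+t. indicator {0<..} t * emeasure lborel {x. t < g x} \<partial>lborel)"
    using f g by (simp add: nn_integral_superlevel_sets)
  also have "\<dots> = (\<integral>\<^sup>+t. indicator {0<..} t * emeasure lborel {x. t < f x} +
      indicator {0<..} t * emeasure lborel {x. t < g x} \<partial>lborel)"
    by (rule nn_integral_add[symmetric]) measurable
  also have "\<dots> \<le> (\<integral>\<^sup>+t. 2 * (indicator {0<..} t * emeasure lborel {x. t < ?h x}) \<partial>lborel)"
    using level by (intro nn_integral_mono) (auto split: split_indicator)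
  also have "\<dots> = 2 * (\<integral>\<^sup>+t. indicator {0<..} t * emeasure lborel {x. t < ?h x} \<partial>lborel)"
    by (rule nn_integral_cmult) measurable
  also have "(\<integral>\<^sup>+t. indicator {0<..} t * emeasure lborel {x. t < ?h x} \<partial>lborel)
      = (\<integral>\<^sup>+x. ennreal (?h x) \<partial>lborel)"
    using c by (intro nn_integral_superlevel_sets[symmetric]) auto
  also have "\<dots> = ennreal c * ennreal (sqrt (2 * pi))"
    using c by (simp add: ennreal_mult nn_integral_cmult nn_integral_gaussian[simplified])
  also have "2 * (ennreal c * ennreal (sqrt (2 * pi))) = ennreal (2 * c * sqrt (2 * pi))"
    using c by (simp add: ennreal_mult mult.assoc)
  finally show ?thesis .
qed

text \<open>Dividing F and G by their suprema a and b reduces this to the normalised case with c = 1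
  / sqrt(a b). That case bounds a sum of integrals p + q; the inequality 4 p q <= (p + q)^2 turns it
  into the bound on the product.\<close>

lemma prekopa_leindler_gaussian:
  fixes F G :: "real \<Rightarrow> ennreal"
  assumes [measurable]: "F \<in> borel_measurable borel" "G \<in> borel_measurable borel"
    and FG: "\<And>x y. F x * G y \<le> ennreal (exp (- (x + y)\<^sup>2 / 4))"
  shows "(\<integral>\<^sup>+x. F x \<partial>lborel) * (\<integral>\<^sup>+x. G x \<partial>lborel) \<le> ennreal (2 * pi)"
proof (cases "(SUP x. F x) = 0 \<or> (SUP x. G x) = 0")
  case True
  then have "F = (\<lambda>_. 0) \<or> G = (\<lambda>_. 0)"
    by (auto simp: fun_eq_iff simp flip: bot_ennreal)
  then show ?thesis by auto
next
  case False
  have "(SUP x. F x) * (SUP y. G y) = (SUP x. SUP y. F x * G y)"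
    by (simp add: SUP_mult_left_ennreal SUP_mult_right_ennreal) (rule SUP_commute)
  also have "\<dots> \<le> 1"
    by (intro SUP_least order.trans[OF FG]) (simp flip: ennreal_1)
  finally have le1: "(SUP x. F x) * (SUP y. G y) \<le> 1" .
  \<comment> \<open>The product of the suprema is at most 1, and neither is 0, so an infinite one
    would make the product infinite.\<close>
  have "A \<noteq> \<infinity> \<and> B \<noteq> \<infinity>" if "A * B \<le> 1" "A \<noteq> 0" "B \<noteq> 0" for A B :: ennreal
    using that by (auto simp: ennreal_top_mult ennreal_mult_top top_unique)
  then have "(SUP x. F x) \<noteq> \<infinity>" "(SUP x. G x) \<noteq> \<infinity>"
    using le1 False by blast+
  moreover have "\<exists>a>0. A = ennreal a" if "A \<noteq> \<infinity>" "A \<noteq> 0" for A :: ennreal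
    using that by (cases A) (auto intro!: exI)
  ultimately obtain a b where a: "(SUP x. F x) = ennreal a" "a > 0"
    and b: "(SUP x. G x) = ennreal b" "b > 0"
    using False by meson
  have Fa: "F x \<le> ennreal a" and Gb: "G x \<le> ennreal b" for x
    by (auto simp flip: a b intro: SUP_upper)
  define f g where "f x = enn2real (F x) / a" and "g x = enn2real (G x) / b" for x
  have [measurable]: "f \<in> borel_measurable borel" "g \<in> borel_measurable borel"
    unfolding f_def g_def by measurable
  have Ff: "F x = ennreal a * ennreal (f x)" and Gg: "G x = ennreal b * ennreal (g x)" for x
    using Fa[of x] Gb[of x] a b
    by (auto simp: f_def g_def top_unique simp flip: ennreal_mult intro!: ennreal_enn2real[symmetric] le_less_trans[OF _ ennreal_less_top])
  define c where "c = 1 / sqrt (a * b)"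
  have c: "c > 0" "c\<^sup>2 = 1 / (a * b)" using a b by (auto simp: c_def power_divide)
  have bd: "0 \<le> f x" "f x \<le> 1" "0 \<le> g x" "g x \<le> 1" for x
    using Fa[of x] Gb[of x] a b
    by (auto simp: f_def g_def intro: enn2real_leI)
  have "(\<integral>\<^sup>+x. f x \<partial>lborel) + (\<integral>\<^sup>+x. g x \<partial>lborel) \<le> ennreal (2 * c * sqrt (2 * pi))"
  proof (rule prekopa_leindler_gaussian_normalised)
    fix t :: real assume t: "t < 1"
    have "ennreal (a * t) < (SUP x. F x)" using t a by (simp add: ennreal_less_iff ennreal_lessI)
    then obtain x where "ennreal (a * t) < F x" by (auto simp: less_SUP_iff)
    then have "ennreal (a * t) < ennreal (a * f x)" using a bd by (simp add: Ff ennreal_mult)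
    then have "a * t < a * f x" by (meson ennreal_leI not_le)
    then show "\<exists>x. t < f x" using a by auto
  next
    fix t :: real assume t: "t < 1"
    have "ennreal (b * t) < (SUP x. G x)" using t b by (simp add: ennreal_less_iff ennreal_lessI)
    then obtain x where "ennreal (b * t) < G x" by (auto simp: less_SUP_iff)
    then have "ennreal (b * t) < ennreal (b * g x)" using b bd by (simp add: Gg ennreal_mult)
    then have "b * t < b * g x" by (meson ennreal_leI not_le)
    then show "\<exists>x. t < g x" using b by auto
  next
    fix x y
    have "ennreal ((a * f x) * (b * g y)) \<le> ennreal (exp (- (x + y)\<^sup>2 / 4))"
      using FG[of x y] a b bd by (simp add: Ff Gg ennreal_mult)
    then have "(a * b) * (f x * g y) \<le> exp (- (x + y)\<^sup>2 / 4)" by (simp add: mult_ac)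
    also have "exp (- (x + y)\<^sup>2 / 4) = (exp (- ((x + y) / 2)\<^sup>2 / 2))\<^sup>2"
      by (simp add: power_divide flip: exp_double)
    finally have "c\<^sup>2 * ((a * b) * (f x * g y)) \<le> c\<^sup>2 * (exp (- ((x + y) / 2)\<^sup>2 / 2))\<^sup>2"
      by (rule mult_left_mono) simp
    moreover have "c\<^sup>2 * ((a * b) * (f x * g y)) = f x * g y" using a b c(2) by simp
    ultimately show "f x * g y \<le> (c * exp (- ((x + y) / 2)\<^sup>2 / 2))\<^sup>2"
      by (simp only: power_mult_distrib)
  qed (use bd c in auto)
  moreover obtain p where p: "(\<integral>\<^sup>+x. f x \<partial>lborel) = ennreal p" "p \<ge> 0"
    using calculation by (cases "\<integral>\<^sup>+x. f x \<partial>lborel") (auto simp: top_unique)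
  moreover obtain q where q: "(\<integral>\<^sup>+x. g x \<partial>lborel) = ennreal q" "q \<ge> 0"
    using calculation by (cases "\<integral>\<^sup>+x. g x \<partial>lborel") (auto simp: top_unique)
  ultimately have pq: "p + q \<le> 2 * c * sqrt (2 * pi)"
    using c by (simp flip: ennreal_plus)
  have "4 * (p * q) \<le> (p + q)\<^sup>2" using zero_le_power2[of "p - q"] by (simp add: power2_eq_square algebra_simps)
  also have "\<dots> \<le> (2 * c * sqrt (2 * pi))\<^sup>2" using pq p q by (intro power_mono) auto
  also have "\<dots> = 4 * (2 * pi / (a * b))" using c by (simp add: power_mult_distrib)
  finally have "a * b * (p * q) \<le> 2 * pi" using a b by (simp add: field_simps)
  moreover have "(\<integral>\<^sup>+x. F x \<partial>lborel) * (\<integral>\<^sup>+x. G x \<partial>lborel) = ennreal (a * b * (p * q))"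
    using a b p q by (simp add: Ff Gg nn_integral_cmult ennreal_mult mult_ac)
  ultimately show ?thesis by (simp add: ennreal_leI)
qed

section \<open>Gaussian concentration\<close>

abbreviation std_normal :: "real measure" where
  "std_normal \<equiv> density lborel (\<lambda>x. ennreal (std_normal_density x))"

definition gauss :: "nat set \<Rightarrow> (nat \<Rightarrow> real) measure" where
  "gauss K = (\<Pi>\<^sub>M k\<in>K. std_normal)"

interpretation std_normal: prob_space std_normal
  by (rule prob_space_normal_density) simp

interpretation std_normals: product_sigma_finite "\<lambda>_::nat. std_normal" ..

lemma sets_gauss [measurable_cong]: "sets (gauss K) = sets (\<Pi>\<^sub>M k\<in>K. lborel)"
  unfolding gauss_def by (intro sets_PiM_cong) auto

lemma space_gauss [simp]: "space (gauss K) = K \<rightarrow>\<^sub>E UNIV"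
  by (simp add: gauss_def space_PiM)

lemma prob_space_gauss: "prob_space (gauss K)"
  unfolding gauss_def by (rule prob_space_PiM) (rule std_normal.prob_space_axioms)

lemma nn_integral_std_normal:
  assumes [measurable]: "f \<in> borel_measurable borel"
  shows "(\<integral>\<^sup>+x. f x \<partial>std_normal) = (\<integral>\<^sup>+x. ennreal (std_normal_density x) * f x \<partial>lborel)"
  by (rule nn_integral_density) auto

text \<open>Cones are measured by Lebesgue volume, so the Gaussian has to be expressed by it. Both
  measures factor on boxes, and boxes determine the product measure.\<close>

lemma gauss_eq_density:
  assumes fin: "finite K"
  shows "gauss K = density (\<Pi>\<^sub>M k\<in>K. lborel) (\<lambda>z. ennreal (\<Prod>k\<in>K. std_normal_density (z k)))"
proof -
  interpret lb: product_sigma_finite "\<lambda>_::nat. (lborel :: real measure)" by standard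
  show ?thesis unfolding gauss_def
  proof (rule std_normals.PiM_eqI[symmetric, OF fin])
    show "sets (density (\<Pi>\<^sub>M k\<in>K. lborel) (\<lambda>z. ennreal (\<Prod>k\<in>K. std_normal_density (z k)))) =
        sets (\<Pi>\<^sub>M k\<in>K. std_normal)"
      using sets_gauss[of K] by (simp add: gauss_def)
    fix A :: "nat \<Rightarrow> real set" assume A: "\<And>k. k \<in> K \<Longrightarrow> A k \<in> sets std_normal"
    then have [measurable]: "\<And>k. k \<in> K \<Longrightarrow> A k \<in> sets borel" by simp
    have "Pi\<^sub>E K A \<in> sets (\<Pi>\<^sub>M k\<in>K. (lborel :: real measure))"
      using fin by (intro sets_PiM_I_finite) auto
    then have "emeasure (density (\<Pi>\<^sub>M k\<in>K. lborel) (\<lambda>z. ennreal (\<Prod>k\<in>K. std_normal_density (z k)))) (Pi\<^sub>E K A)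
      = (\<integral>\<^sup>+z. ennreal (\<Prod>k\<in>K. std_normal_density (z k)) * indicator (Pi\<^sub>E K A) z \<partial>(\<Pi>\<^sub>M k\<in>K. lborel))"
      by (rule emeasure_density[rotated]) measurable
    also have "\<dots> = (\<integral>\<^sup>+z. (\<Prod>k\<in>K. ennreal (std_normal_density (z k)) * indicator (A k) (z k)) \<partial>(\<Pi>\<^sub>M k\<in>K. lborel))"
    proof (rule nn_integral_cong)
      fix z assume z: "z \<in> space (\<Pi>\<^sub>M k\<in>K. (lborel :: real measure))"
      have "(indicator (Pi\<^sub>E K A) z :: ennreal) = (\<Prod>k\<in>K. indicator (A k) (z k))"
        using z fin by (auto simp: space_PiM PiE_iff prod_zero_iff split: split_indicator)
      then show "ennreal (\<Prod>k\<in>K. std_normal_density (z k)) * indicator (Pi\<^sub>E K A) z =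
          (\<Prod>k\<in>K. ennreal (std_normal_density (z k)) * indicator (A k) (z k))"
        by (simp add: prod.distrib prod_ennreal)
    qed
    also have "\<dots> = (\<Prod>k\<in>K. \<integral>\<^sup>+x. ennreal (std_normal_density x) * indicator (A k) x \<partial>lborel)"
      using fin by (intro lb.product_nn_integral_prod) auto
    also have "\<dots> = (\<Prod>k\<in>K. emeasure std_normal (A k))"
      by (intro prod.cong refl emeasure_density[symmetric]) auto
    finally show "emeasure (density (\<Pi>\<^sub>M k\<in>K. lborel) (\<lambda>z. ennreal (\<Prod>k\<in>K. std_normal_density (z k)))) (Pi\<^sub>E K A)
      = (\<Prod>k\<in>K. emeasure std_normal (A k))" .
  qed
qed

text \<open>Property (tau) of Maurey, in a form without infimum convolution, so that no measurability
  question arises and the tensorisation is immediate.\<close>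
lemma property_tau_std_normal:
  fixes u v :: "real \<Rightarrow> ennreal"
  assumes [measurable]: "u \<in> borel_measurable borel" "v \<in> borel_measurable borel"
    and c: "c > 0"
    and uv: "\<And>x y. u x * v y \<le> ennreal (c * exp ((x - y)\<^sup>2 / 4))"
  shows "(\<integral>\<^sup>+x. u x \<partial>std_normal) * (\<integral>\<^sup>+x. v x \<partial>std_normal) \<le> ennreal c"
proof -
  \<comment> \<open>The Gaussian weights and the constant c are absorbed into F and G, which puts
    the hypothesis into Prekopa-Leindler form.\<close>
  define F where "F x = ennreal (exp (- x\<^sup>2 / 2) / c) * u x" for x
  define G where "G x = ennreal (exp (- x\<^sup>2 / 2)) * v x" for x
  have [measurable]: "F \<in> borel_measurable borel" "G \<in> borel_measurable borel"
    unfolding F_def G_def by measurable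
  have FG: "(\<integral>\<^sup>+x. F x \<partial>lborel) * (\<integral>\<^sup>+x. G x \<partial>lborel) \<le> ennreal (2 * pi)"
  proof (rule prekopa_leindler_gaussian)
    fix x y
    have "F x * G y = ennreal (exp (- x\<^sup>2 / 2) / c * exp (- y\<^sup>2 / 2)) * (u x * v y)"
      using c unfolding F_def G_def by (subst ennreal_mult) (auto simp: mult_ac)
    also have "\<dots> \<le> ennreal (exp (- x\<^sup>2 / 2) / c * exp (- y\<^sup>2 / 2)) * ennreal (c * exp ((x - y)\<^sup>2 / 4))"
      by (intro mult_left_mono uv) simp
    also have "\<dots> = ennreal (exp (- x\<^sup>2 / 2) * exp (- y\<^sup>2 / 2) * exp ((x - y)\<^sup>2 / 4))"
      using c by (simp flip: ennreal_mult)
    \<comment> \<open>Parallelogram law: -x^2/2 - y^2/2 + (x - y)^2/4 = -(x + y)^2/4.\<close>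
    also have "exp (- x\<^sup>2 / 2) * exp (- y\<^sup>2 / 2) * exp ((x - y)\<^sup>2 / 4) = exp (- (x + y)\<^sup>2 / 4)"
      unfolding exp_add[symmetric] by (rule arg_cong[of _ _ exp]) (simp add: power2_eq_square field_simps)
    finally show "F x * G y \<le> ennreal (exp (- (x + y)\<^sup>2 / 4))" .
  qed measurable
  have "(\<integral>\<^sup>+x. u x \<partial>std_normal) = ennreal (c / sqrt (2 * pi)) * (\<integral>\<^sup>+x. F x \<partial>lborel)"
    unfolding nn_integral_std_normal[OF assms(1)] F_def
    by (subst nn_integral_cmult[symmetric], measurable, intro nn_integral_cong)
       (use c in \<open>simp add: std_normal_density_def flip: mult.assoc ennreal_mult\<close>)
  moreover have "(\<integral>\<^sup>+x. v x \<partial>std_normal) = ennreal (1 / sqrt (2 * pi)) * (\<integral>\<^sup>+x. G x \<partial>lborel)"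
    unfolding nn_integral_std_normal[OF assms(2)] G_def
    by (subst nn_integral_cmult[symmetric], measurable, intro nn_integral_cong)
       (simp add: std_normal_density_def flip: mult.assoc ennreal_mult)
  ultimately have "(\<integral>\<^sup>+x. u x \<partial>std_normal) * (\<integral>\<^sup>+x. v x \<partial>std_normal) =
      ennreal (c / sqrt (2 * pi)) * ennreal (1 / sqrt (2 * pi)) *
        ((\<integral>\<^sup>+x. F x \<partial>lborel) * (\<integral>\<^sup>+x. G x \<partial>lborel))"
    by (simp only: mult_ac)
  also have "\<dots> \<le> ennreal (c / sqrt (2 * pi)) * ennreal (1 / sqrt (2 * pi)) * ennreal (2 * pi)"
    by (intro mult_left_mono FG) simp
  also have "\<dots> = ennreal c" using c by (simp flip: ennreal_mult)
  finally show ?thesis .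
qed

text \<open>Tensorisation: with the other coordinates x and y frozen, the one-dimensional property
  in coordinate i applies with c = exp(|x - y|^2 / 4), which is why it carries a constant. Its
  conclusion says that the inner integrals, as functions of x and y, satisfy the hypothesis for
  K.\<close>

lemma property_tau_gauss:
  assumes "finite K"
    and "u \<in> borel_measurable (gauss K)" "v \<in> borel_measurable (gauss K)"
    and "\<And>x y. x \<in> K \<rightarrow>\<^sub>E UNIV \<Longrightarrow> y \<in> K \<rightarrow>\<^sub>E UNIV \<Longrightarrow>
      u x * v y \<le> ennreal (exp ((\<Sum>k\<in>K. (x k - y k)\<^sup>2) / 4))"
  shows "(\<integral>\<^sup>+x. u x \<partial>gauss K) * (\<integral>\<^sup>+x. v x \<partial>gauss K) \<le> 1"
  using assms
proof (induction K arbitrary: u v rule: finite_induct)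
  case empty
  \<comment> \<open>Over the empty index set the product space has the single point
    \<open>\<lambda>_. undefined\<close>, where the hypothesis reads exp 0 = 1.\<close>
  have "u (\<lambda>_. undefined) * v (\<lambda>_. undefined) \<le> 1" using empty(3) by force
  then show ?case by (simp add: gauss_def PiM_empty nn_integral_count_space_finite)
next
  case (insert i K)
  have [measurable]: "u \<in> borel_measurable (\<Pi>\<^sub>M k\<in>insert i K. std_normal)"
    "v \<in> borel_measurable (\<Pi>\<^sub>M k\<in>insert i K. std_normal)"
    using insert.prems(1,2) by (simp_all add: gauss_def)
  have m: "(\<lambda>t. w (x(i := t))) \<in> borel_measurable borel"
    if [measurable]: "w \<in> borel_measurable (\<Pi>\<^sub>M k\<in>insert i K. std_normal)" and x: "x \<in> K \<rightarrow>\<^sub>E UNIV"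
    for w :: "(nat \<Rightarrow> real) \<Rightarrow> ennreal" and x
  proof -
    have [measurable]: "x \<in> space (\<Pi>\<^sub>M k\<in>K. std_normal)" using x by (simp add: space_PiM)
    have "(\<lambda>t. w (x(i := t))) \<in> borel_measurable std_normal" by measurable
    then show ?thesis by simp
  qed
  have "(\<integral>\<^sup>+x. (\<integral>\<^sup>+t. u (x(i := t)) \<partial>std_normal) \<partial>gauss K) *
      (\<integral>\<^sup>+x. (\<integral>\<^sup>+t. v (x(i := t)) \<partial>std_normal) \<partial>gauss K) \<le> 1"
  proof (rule insert.IH)
    show "(\<lambda>x. \<integral>\<^sup>+t. u (x(i := t)) \<partial>std_normal) \<in> borel_measurable (gauss K)"
      "(\<lambda>x. \<integral>\<^sup>+t. v (x(i := t)) \<partial>std_normal) \<in> borel_measurable (gauss K)"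
      unfolding gauss_def by measurable
    fix x y :: "nat \<Rightarrow> real" assume x: "x \<in> K \<rightarrow>\<^sub>E UNIV" and y: "y \<in> K \<rightarrow>\<^sub>E UNIV"
    show "(\<integral>\<^sup>+t. u (x(i := t)) \<partial>std_normal) * (\<integral>\<^sup>+t. v (y(i := t)) \<partial>std_normal)
        \<le> ennreal (exp ((\<Sum>k\<in>K. (x k - y k)\<^sup>2) / 4))"
    proof (rule property_tau_std_normal)
      show "(\<lambda>t. u (x(i := t))) \<in> borel_measurable borel" "(\<lambda>t. v (y(i := t))) \<in> borel_measurable borel"
        using x y by (auto intro!: m)
      fix s t
      have "u (x(i := s)) * v (y(i := t)) \<le>
          ennreal (exp ((\<Sum>k\<in>insert i K. ((x(i := s)) k - (y(i := t)) k)\<^sup>2) / 4))"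
        using x y by (intro insert.prems(3)) (auto simp: PiE_iff extensional_def)
      also have "(\<Sum>k\<in>insert i K. ((x(i := s)) k - (y(i := t)) k)\<^sup>2) = (s - t)\<^sup>2 + (\<Sum>k\<in>K. (x k - y k)\<^sup>2)"
        using insert.hyps by (simp, intro sum.cong) auto
      also have "ennreal (exp (((s - t)\<^sup>2 + (\<Sum>k\<in>K. (x k - y k)\<^sup>2)) / 4)) =
          ennreal (exp ((\<Sum>k\<in>K. (x k - y k)\<^sup>2) / 4) * exp ((s - t)\<^sup>2 / 4))"
        by (simp add: add_divide_distrib exp_add mult.commute)
      finally show "u (x(i := s)) * v (y(i := t)) \<le>
          ennreal (exp ((\<Sum>k\<in>K. (x k - y k)\<^sup>2) / 4) * exp ((s - t)\<^sup>2 / 4))" .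
    qed simp
  qed
  then show ?case
    using insert.hyps by (simp add: gauss_def std_normals.product_nn_integral_insert)
qed

text \<open>Property (tau) for exp(d^2/4) times the indicator of A and the indicator of B: its
  hypothesis has content only on A x B, where it is the separation.\<close>

lemma gauss_separated_sets:
  assumes fin: "finite K" and A[measurable]: "A \<in> sets (gauss K)" and B[measurable]: "B \<in> sets (gauss K)"
    and sep: "\<And>x y. x \<in> A \<Longrightarrow> y \<in> B \<Longrightarrow> d\<^sup>2 \<le> (\<Sum>k\<in>K. (x k - y k)\<^sup>2)"
  shows "measure (gauss K) A * measure (gauss K) B \<le> exp (- d\<^sup>2 / 4)"
proof -
  interpret prob_space "gauss K" by (rule prob_space_gauss)
  have "(\<integral>\<^sup>+x. ennreal (exp (d\<^sup>2 / 4)) * indicator A x \<partial>gauss K) * (\<integral>\<^sup>+x. indicator B x \<partial>gauss K) \<le> 1"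
  proof (rule property_tau_gauss[OF fin])
    fix x y :: "nat \<Rightarrow> real"
    show "ennreal (exp (d\<^sup>2 / 4)) * indicator A x * indicator B y
        \<le> ennreal (exp ((\<Sum>k\<in>K. (x k - y k)\<^sup>2) / 4))"
      using sep[of x y] by (auto split: split_indicator)
  qed measurable
  then have "ennreal (exp (d\<^sup>2 / 4) * measure (gauss K) A * measure (gauss K) B) \<le> ennreal 1"
    by (simp add: nn_integral_cmult emeasure_eq_measure flip: ennreal_mult)
  then have "exp (d\<^sup>2 / 4) * (measure (gauss K) A * measure (gauss K) B) \<le> 1"
    by (simp add: mult.assoc)
  then show ?thesis by (simp add: exp_minus field_simps)
qed

section \<open>Gaussian moments\<close>

lemma nn_integral_normal_density:
  assumes "\<sigma> > 0"
  shows "(\<integral>\<^sup>+x. ennreal (normal_density \<mu> \<sigma> x) \<partial>lborel) = 1"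
  using assms by (subst nn_integral_eq_integral) auto

lemma std_normal_exp_linear:
  "(\<integral>\<^sup>+x. ennreal (exp (c * x)) \<partial>std_normal) = ennreal (exp (c\<^sup>2 / 2))"
proof -
  have "std_normal_density x * exp (c * x) = exp (c\<^sup>2 / 2) * normal_density c 1 x" for x
  proof -
    have "exp (- x\<^sup>2 / 2) * exp (c * x) = exp (c\<^sup>2 / 2) * exp (- (x - c)\<^sup>2 / 2)"
      unfolding exp_add[symmetric] by (rule arg_cong[of _ _ exp]) (simp add: power2_eq_square field_simps)
    then show ?thesis by (simp add: normal_density_def)
  qed
  then have "(\<integral>\<^sup>+x. ennreal (exp (c * x)) \<partial>std_normal) =
      (\<integral>\<^sup>+x. ennreal (exp (c\<^sup>2 / 2)) * ennreal (normal_density c 1 x) \<partial>lborel)"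
    by (simp add: nn_integral_std_normal flip: ennreal_mult)
  then show ?thesis by (simp add: nn_integral_cmult nn_integral_normal_density)
qed

text \<open>As x^2/2 + x^2/6 = x^2 / (2 * (3/4)), the integrand is a multiple of the density with
  variance 3/4. The parameter 1/6 is the optimal Chernoff parameter t for the small-ball threshold
  3/4: it solves 1 / (1 + 2t) = 3/4.\<close>

lemma std_normal_exp_square:
  "(\<integral>\<^sup>+x. ennreal (exp (- x\<^sup>2 / 6)) \<partial>std_normal) = ennreal (sqrt (3 / 4))"
proof -
  have "std_normal_density x * exp (- x\<^sup>2 / 6) = sqrt (3 / 4) * normal_density 0 (sqrt (3 / 4)) x" for x
  proof -
    have "exp (- x\<^sup>2 / 2) * exp (- x\<^sup>2 / 6) = exp (- x\<^sup>2 / (2 * (3 / 4)))"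
      unfolding exp_add[symmetric] by (rule arg_cong[of _ _ exp]) (simp add: field_simps)
    moreover have "normal_density 0 s x = 1 / (sqrt (2 * pi) * s) * exp (- x\<^sup>2 / (2 * s\<^sup>2))" if "s > 0" for s
      using that by (simp add: normal_density_def real_sqrt_mult)
    moreover have "sqrt (3 / 4 :: real) > 0" "(sqrt (3 / 4 :: real))\<^sup>2 = 3 / 4" by simp_all
    ultimately show ?thesis by (simp only: std_normal_density_def) (simp add: mult.assoc)
  qed
  then have "(\<integral>\<^sup>+x. ennreal (exp (- x\<^sup>2 / 6)) \<partial>std_normal) =
      (\<integral>\<^sup>+x. ennreal (sqrt (3 / 4)) * ennreal (normal_density 0 (sqrt (3 / 4)) x) \<partial>lborel)"
    by (simp add: nn_integral_std_normal flip: ennreal_mult)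
  then show ?thesis by (simp add: nn_integral_cmult nn_integral_normal_density)
qed

lemma gauss_exp_linear:
  assumes fin: "finite K"
  shows "(\<integral>\<^sup>+z. ennreal (exp (\<Sum>k\<in>K. c k * z k)) \<partial>gauss K) = ennreal (exp ((\<Sum>k\<in>K. (c k)\<^sup>2) / 2))"
proof -
  have "(\<integral>\<^sup>+z. ennreal (exp (\<Sum>k\<in>K. c k * z k)) \<partial>gauss K) =
      (\<integral>\<^sup>+z. (\<Prod>k\<in>K. ennreal (exp (c k * z k))) \<partial>(\<Pi>\<^sub>M k\<in>K. std_normal))"
    unfolding gauss_def using fin by (simp add: exp_sum prod_ennreal)
  also have "\<dots> = (\<Prod>k\<in>K. \<integral>\<^sup>+x. ennreal (exp (c k * x)) \<partial>std_normal)"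
    using fin by (intro std_normals.product_nn_integral_prod) auto
  also have "\<dots> = ennreal (exp ((\<Sum>k\<in>K. (c k)\<^sup>2) / 2))"
    using fin by (simp add: std_normal_exp_linear prod_ennreal exp_sum sum_divide_distrib)
  finally show ?thesis .
qed

lemma gauss_exp_square:
  assumes fin: "finite K"
  shows "(\<integral>\<^sup>+z. ennreal (exp (- (\<Sum>k\<in>K. (z k)\<^sup>2) / 6)) \<partial>gauss K) = ennreal (sqrt (3 / 4) ^ card K)"
proof -
  have "(\<integral>\<^sup>+z. ennreal (exp (- (\<Sum>k\<in>K. (z k)\<^sup>2) / 6)) \<partial>gauss K) =
      (\<integral>\<^sup>+z. (\<Prod>k\<in>K. ennreal (exp (- (z k)\<^sup>2 / 6))) \<partial>(\<Pi>\<^sub>M k\<in>K. std_normal))"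
  proof -
    have "exp (- (\<Sum>k\<in>K. (z k)\<^sup>2) / 6) = (\<Prod>k\<in>K. exp (- (z k)\<^sup>2 / 6))" for z :: "nat \<Rightarrow> real"
      using fin by (simp add: sum_divide_distrib flip: exp_sum sum_negf)
    then show ?thesis unfolding gauss_def by (simp add: prod_ennreal)
  qed
  also have "\<dots> = (\<Prod>k\<in>K. \<integral>\<^sup>+x. ennreal (exp (- x\<^sup>2 / 6)) \<partial>std_normal)"
    using fin by (intro std_normals.product_nn_integral_prod) auto
  also have "\<dots> = ennreal (sqrt (3 / 4) ^ card K)"
    using fin std_normal_exp_square by (simp add: ennreal_power)
  finally show ?thesis .
qed

lemma powr_le_exp:
  fixes t q :: real
  assumes "t \<ge> 0" "q > 0"
  shows "t powr q \<le> exp (q * (t - 1))"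
proof (cases "t = 0")
  case False
  then have "q * ln t \<le> q * (t - 1)" using assms by (intro mult_left_mono ln_le_minus_one) auto
  then show ?thesis using False assms by (simp add: powr_def)
qed simp

text \<open>Moments of real order come from exponential moments through |x|^q <= m^q exp(q (|x|/m -
  1)), so no Gamma function appears. The factor 2 comes from splitting exp(l |x|) into its two
  signs.\<close>

lemma gauss_abs_linear_moment:
  assumes fin: "finite K" and q: "q > 0"
  shows "(\<integral>\<^sup>+z. ennreal (\<bar>\<Sum>k\<in>K. c k * z k\<bar> powr q) \<partial>gauss K)
    \<le> ennreal (2 * (q * (\<Sum>k\<in>K. (c k)\<^sup>2)) powr (q / 2))"
proof -
  define a where "a = (\<Sum>k\<in>K. (c k)\<^sup>2)"
  have a0: "a \<ge> 0" by (simp add: a_def sum_nonneg)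
  show ?thesis
  \<comment> \<open>A form of zero variance vanishes identically; otherwise a may be a
    divisor.\<close>
  proof (cases "a = 0")
    case True
    then have "\<And>k. k \<in> K \<Longrightarrow> c k = 0" using fin by (simp add: a_def sum_nonneg_eq_0_iff)
    then have "(\<Sum>k\<in>K. c k * z k) = 0" for z :: "nat \<Rightarrow> real" by simp
    then show ?thesis by simp
  next
    case False
    then have a: "a > 0" using a0 by simp
    \<comment> \<open>The scale m = sqrt(q a) makes the rate l = q/m satisfy l^2 a = q, so each
      exponential moment is exp(q/2) and the prefactor exp(-q) more than compensates it.\<close>
    define l where "l = sqrt (q / a)"
    define m where "m = sqrt (q * a)"
    have l: "l > 0" "l\<^sup>2 * a = q" using a q by (auto simp: l_def)
    have m: "m > 0" "m powr q = (q * a) powr (q / 2)" using a q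
      by (auto simp: m_def powr_half_sqrt[symmetric] powr_powr)
    have lm: "l * m = q" using a q
      by (simp add: l_def m_def flip: real_sqrt_mult)
    have bound: "\<bar>x\<bar> powr q \<le> m powr q * exp (- q) * (exp (l * x) + exp (- l * x))" for x
    proof -
      have "\<bar>x\<bar> powr q = m powr q * (\<bar>x\<bar> / m) powr q"
        using m(1) by (simp flip: powr_mult)
      also have "\<dots> \<le> m powr q * exp (q * (\<bar>x\<bar> / m - 1))"
        using m(1) q by (intro mult_left_mono powr_le_exp) auto
      also have "q * (\<bar>x\<bar> / m - 1) = - q + l * \<bar>x\<bar>"
        using m(1) by (simp add: field_simps flip: lm)
      also have "exp (- q + l * \<bar>x\<bar>) \<le> exp (- q) * (exp (l * x) + exp (- l * x))"
        unfolding exp_add by (cases "x \<ge> 0") auto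
      finally show ?thesis using m(1) by (simp add: mult.assoc)
    qed
    let ?L = "\<lambda>z::nat \<Rightarrow> real. \<Sum>k\<in>K. c k * z k"
    have E: "(\<integral>\<^sup>+z. ennreal (exp (s * ?L z)) \<partial>gauss K) = ennreal (exp (q / 2))" if "s = l \<or> s = - l" for s
    proof -
      have "(\<integral>\<^sup>+z. ennreal (exp (s * ?L z)) \<partial>gauss K) = ennreal (exp ((\<Sum>k\<in>K. (s * c k)\<^sup>2) / 2))"
        using gauss_exp_linear[OF fin, of "\<lambda>k. s * c k"] by (simp add: sum_distrib_left mult.assoc)
      also have "(\<Sum>k\<in>K. (s * c k)\<^sup>2) = s\<^sup>2 * a" by (simp add: a_def power_mult_distrib sum_distrib_left)
      also have "\<dots> = q" using that l by auto
      finally show ?thesis .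
    qed
    have [measurable]: "(\<lambda>z. ?L z) \<in> borel_measurable (gauss K)" by measurable
    have "(\<integral>\<^sup>+z. ennreal (\<bar>?L z\<bar> powr q) \<partial>gauss K) \<le>
        (\<integral>\<^sup>+z. ennreal (m powr q * exp (- q)) * (ennreal (exp (l * ?L z)) + ennreal (exp (- l * ?L z))) \<partial>gauss K)"
      using bound by (intro nn_integral_mono) (simp flip: ennreal_plus ennreal_mult)
    also have "\<dots> = ennreal (m powr q * exp (- q)) * (ennreal (exp (q / 2)) + ennreal (exp (q / 2)))"
      unfolding E[OF disjI1[OF refl], symmetric]
      by (subst nn_integral_cmult, measurable, subst nn_integral_add)
         (simp_all only: E simp_thms, measurable)
    also have "\<dots> = ennreal (2 * (m powr q * (exp (- q) * exp (q / 2))))"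
      by (simp flip: ennreal_plus ennreal_mult)
    also have "\<dots> \<le> ennreal (2 * (m powr q * 1))"
      using q by (intro ennreal_leI mult_left_mono) (auto simp flip: exp_add)
    finally show ?thesis using m(2) by (simp add: a_def)
  qed
qed

text \<open>Chernoff bound with parameter 1/6, where n/8 = (1/6)(3/4) n. The base exp(1/8) sqrt(3/4)
  is below 127/128; only a bound uniform in the dimension is wanted, so the power n is finally
  weakened to 1.\<close>

lemma gauss_small_ball:
  assumes fin: "finite K" and ne: "K \<noteq> {}"
  shows "measure (gauss K) {z \<in> space (gauss K). (\<Sum>k\<in>K. (z k)\<^sup>2) \<le> 3 / 4 * card K} \<le> 127 / 128"
proof -
  interpret prob_space "gauss K" by (rule prob_space_gauss)
  let ?n = "card K" and ?A = "{z \<in> space (gauss K). (\<Sum>k\<in>K. (z k)\<^sup>2) \<le> 3 / 4 * card K}"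
  have [measurable]: "(\<lambda>z. \<Sum>k\<in>K. (z k)\<^sup>2) \<in> borel_measurable (gauss K)" by measurable
  have "emeasure (gauss K) ?A = (\<integral>\<^sup>+z. indicator ?A z \<partial>gauss K)"
    by (rule nn_integral_indicator[symmetric]) measurable
  also have "\<dots> \<le> (\<integral>\<^sup>+z. ennreal (exp (?n / 8)) * ennreal (exp (- (\<Sum>k\<in>K. (z k)\<^sup>2) / 6)) \<partial>gauss K)"
  proof (rule nn_integral_mono)
    fix z
    have "1 \<le> exp (?n / 8 + - (\<Sum>k\<in>K. (z k)\<^sup>2) / 6)" if "(\<Sum>k\<in>K. (z k)\<^sup>2) \<le> 3 / 4 * ?n"
      using that by simp
    then show "indicator ?A z \<le> ennreal (exp (?n / 8)) * ennreal (exp (- (\<Sum>k\<in>K. (z k)\<^sup>2) / 6))"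
      unfolding exp_add by (auto split: split_indicator simp flip: ennreal_mult)
  qed
  also have "\<dots> = ennreal (exp (?n / 8)) * ennreal (sqrt (3 / 4) ^ ?n)"
    by (subst nn_integral_cmult) (simp_all only: gauss_exp_square[OF fin], measurable)
  also have "\<dots> = ennreal ((exp (1 / 8) * sqrt (3 / 4)) ^ ?n)"
    by (simp add: power_mult_distrib flip: ennreal_mult exp_of_nat_mult)
  finally have "measure (gauss K) ?A \<le> (exp (1 / 8) * sqrt (3 / 4)) ^ ?n"
    by (simp add: emeasure_eq_measure)
  also have "\<dots> \<le> (127 / 128) ^ ?n"
  proof (rule power_mono)
    \<comment> \<open>The value 21/16 is 1 + x + x^2 at x = 1/4, and (21/16)(3/4) = 63/64 lies just
      below (127/128)^2.\<close>
    have "exp (1 / 4 :: real) \<le> 21 / 16" using exp_bound[of "1 / 4"] by (simp add: power2_eq_square)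
    moreover have "(exp (1 / 8) * sqrt (3 / 4))\<^sup>2 = exp (1 / 4) * (3 / 4 :: real)"
      by (simp add: power_mult_distrib flip: exp_double)
    ultimately have "(exp (1 / 8) * sqrt (3 / 4))\<^sup>2 \<le> (127 / 128 :: real)\<^sup>2"
      by (simp add: power2_eq_square)
    then show "exp (1 / 8) * sqrt (3 / 4) \<le> (127 / 128 :: real)"
      by (rule power2_le_imp_le) simp
  qed simp
  also have "\<dots> \<le> (127 / 128) ^ 1"
    using fin ne by (intro power_decreasing) (auto simp: Suc_le_eq card_gt_0_iff)
  finally show ?thesis by simp
qed

section \<open>Direction and radius of a Gaussian vector\<close>

text \<open>A dilation is an affine substitution in each coordinate, carried out one coordinate at a
  time by Fubini. The restriction to K keeps the dilated point in the extensional product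
  space.\<close>

lemma nn_integral_PiM_scale:
  fixes K :: "nat set" and f :: "(nat \<Rightarrow> real) \<Rightarrow> ennreal"
  assumes "finite K" and "f \<in> borel_measurable (\<Pi>\<^sub>M k\<in>K. lborel)" and c: "c > 0"
  shows "(\<integral>\<^sup>+z. f z \<partial>(\<Pi>\<^sub>M k\<in>K. lborel)) =
    ennreal (c ^ card K) * (\<integral>\<^sup>+z. f (\<lambda>k\<in>K. c * z k) \<partial>(\<Pi>\<^sub>M k\<in>K. (lborel :: real measure)))"
  using assms(1,2)
proof (induction K arbitrary: f rule: finite_induct)
  case empty
  then show ?case by (simp add: PiM_empty nn_integral_count_space_finite)
next
  case (insert i K)
  interpret product_sigma_finite "\<lambda>_::nat. (lborel :: real measure)" by standard
  interpret K: sigma_finite_measure "\<Pi>\<^sub>M k\<in>K. (lborel :: real measure)"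
    by (rule sigma_finite[OF insert.hyps(1)])
  note [measurable] = insert.prems
  have [measurable]: "(\<lambda>z. \<lambda>k\<in>insert i K. c * z k) \<in>
      measurable (\<Pi>\<^sub>M k\<in>insert i K. lborel) (\<Pi>\<^sub>M k\<in>insert i K. (lborel :: real measure))"
    by (intro measurable_restrict) measurable
  have up: "(\<lambda>k\<in>insert i K. c * (z(i := t)) k) = (\<lambda>k\<in>K. c * z k)(i := c * t)" for z :: "nat \<Rightarrow> real" and t
    using insert.hyps by (auto simp: fun_eq_iff restrict_def)
  have "(\<integral>\<^sup>+z. f z \<partial>(\<Pi>\<^sub>M k\<in>insert i K. lborel)) =
      (\<integral>\<^sup>+t. (\<integral>\<^sup>+z. f (z(i := t)) \<partial>(\<Pi>\<^sub>M k\<in>K. lborel)) \<partial>lborel)"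
    using insert.hyps by (intro product_nn_integral_insert_rev) auto
  also have "\<dots> = ennreal c * (\<integral>\<^sup>+t. (\<integral>\<^sup>+z. f (z(i := c * t)) \<partial>(\<Pi>\<^sub>M k\<in>K. lborel)) \<partial>lborel)"
    using c by (subst nn_integral_real_affine[where c = c and t = 0], measurable)
  also have "(\<integral>\<^sup>+t. (\<integral>\<^sup>+z. f (z(i := c * t)) \<partial>(\<Pi>\<^sub>M k\<in>K. lborel)) \<partial>lborel) =
      (\<integral>\<^sup>+t. ennreal (c ^ card K) * (\<integral>\<^sup>+z. f ((\<lambda>k\<in>K. c * z k)(i := c * t)) \<partial>(\<Pi>\<^sub>M k\<in>K. lborel)) \<partial>lborel)"
    by (intro nn_integral_cong insert.IH) measurable
  also have "\<dots> = ennreal (c ^ card K) *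
      (\<integral>\<^sup>+t. (\<integral>\<^sup>+z. f (\<lambda>k\<in>insert i K. c * (z(i := t)) k) \<partial>(\<Pi>\<^sub>M k\<in>K. lborel)) \<partial>lborel)"
    unfolding up[symmetric] by (rule nn_integral_cmult) measurable
  also have "(\<integral>\<^sup>+t. (\<integral>\<^sup>+z. f (\<lambda>k\<in>insert i K. c * (z(i := t)) k) \<partial>(\<Pi>\<^sub>M k\<in>K. lborel)) \<partial>lborel) =
      (\<integral>\<^sup>+z. f (\<lambda>k\<in>insert i K. c * z k) \<partial>(\<Pi>\<^sub>M k\<in>insert i K. lborel))"
    using insert.hyps by (intro product_nn_integral_insert_rev[symmetric]) auto
  finally have *: "(\<integral>\<^sup>+z. f z \<partial>(\<Pi>\<^sub>M k\<in>insert i K. lborel)) = ennreal c * (ennreal (c ^ card K) *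
      (\<integral>\<^sup>+z. f (\<lambda>k\<in>insert i K. c * z k) \<partial>(\<Pi>\<^sub>M k\<in>insert i K. lborel)))" .
  have "ennreal (c ^ card (insert i K)) = ennreal c * ennreal (c ^ card K)"
    using insert.hyps c by (simp add: ennreal_mult)
  then show ?case by (simp only: * mult.assoc)
qed

text \<open>These are the events that depend only on the direction z / |z|; the origin has no
  direction and is left out.\<close>

definition cone_set :: "nat set \<Rightarrow> (nat \<Rightarrow> real) set \<Rightarrow> bool" where
  "cone_set K C \<longleftrightarrow> C \<in> sets (\<Pi>\<^sub>M k\<in>K. (lborel :: real measure)) \<and> (\<forall>z\<in>C. 0 < coord_norm K z) \<and>
    (\<forall>c>0. \<forall>z\<in>K \<rightarrow>\<^sub>E UNIV. (\<lambda>k\<in>K. c * z k) \<in> C \<longleftrightarrow> z \<in> C)"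

lemma coord_norm_measurable [measurable]:
  "coord_norm K \<in> borel_measurable (\<Pi>\<^sub>M k\<in>K. (lborel :: real measure))"
  unfolding coord_norm_def[abs_def] by measurable

lemma coord_norm_scale:
  assumes "c \<ge> 0"
  shows "coord_norm K (\<lambda>k\<in>K. c * z k) = c * coord_norm K z"
proof -
  have "(\<Sum>k\<in>K. ((\<lambda>k\<in>K. c * z k) k)\<^sup>2) = c\<^sup>2 * (\<Sum>k\<in>K. (z k)\<^sup>2)"
    by (simp add: power_mult_distrib sum_distrib_left)
  then show ?thesis using assms by (simp add: coord_norm_def real_sqrt_mult)
qed

lemma coord_norm_square: "(coord_norm K z)\<^sup>2 = (\<Sum>k\<in>K. (z k)\<^sup>2)"
  by (simp add: coord_norm_def sum_nonneg)

text \<open>Lebesgue measure is homogeneous of degree \<open>card K\<close> and a cone does not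
  change under dilation. Radii r <= 0 are included, with both sides 0, because the lemma is applied
  to the values of an arbitrary function.\<close>

lemma emeasure_cone_ball:
  assumes fin: "finite K" and C: "cone_set K C"
  shows "emeasure (\<Pi>\<^sub>M k\<in>K. (lborel :: real measure)) {z \<in> C. coord_norm K z \<le> r} =
    ennreal (max r 0 ^ card K * indicator {0<..} r) *
      emeasure (\<Pi>\<^sub>M k\<in>K. (lborel :: real measure)) (C \<inter> punctured_ball K)"
proof (cases "r > 0")
  case False
  then have "{z \<in> C. coord_norm K z \<le> r} = {}" using C by (force simp: cone_set_def)
  then show ?thesis using False by (simp only: emeasure_empty) simp
next
  case r: True
  let ?V = "\<Pi>\<^sub>M k\<in>K. (lborel :: real measure)"
  have Cs[measurable]: "C \<in> sets ?V" using C by (simp add: cone_set_def)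
  have sub: "C \<subseteq> K \<rightarrow>\<^sub>E UNIV" using sets.sets_into_space[OF Cs] by (simp add: space_PiM)
  have eq: "{z \<in> C. coord_norm K z \<le> r} = C \<inter> {z \<in> space ?V. coord_norm K z \<le> r}"
    using sub by (auto simp: space_PiM)
  have m: "{z \<in> C. coord_norm K z \<le> r} \<in> sets ?V" unfolding eq by measurable
  have "emeasure ?V {z \<in> C. coord_norm K z \<le> r} =
      (\<integral>\<^sup>+z. indicator {z \<in> C. coord_norm K z \<le> r} z \<partial>?V)"
    using m by (rule nn_integral_indicator[symmetric])
  also have "\<dots> = ennreal (r ^ card K) *
      (\<integral>\<^sup>+z. indicator {z \<in> C. coord_norm K z \<le> r} (\<lambda>k\<in>K. r * z k) \<partial>?V)"
    using m by (intro nn_integral_PiM_scale fin r) measurable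
  also have "(\<integral>\<^sup>+z. indicator {z \<in> C. coord_norm K z \<le> r} (\<lambda>k\<in>K. r * z k) \<partial>?V) =
      (\<integral>\<^sup>+z. indicator (C \<inter> punctured_ball K) z \<partial>?V)"
  proof (rule nn_integral_cong)
    fix z assume "z \<in> space ?V"
    then have z: "z \<in> K \<rightarrow>\<^sub>E UNIV" by (simp add: space_PiM)
    have "(\<lambda>k\<in>K. r * z k) \<in> C \<longleftrightarrow> z \<in> C" using C r z by (auto simp: cone_set_def)
    moreover have "r * coord_norm K z \<le> r \<longleftrightarrow> coord_norm K z \<le> 1" using r by simp
    ultimately have "(\<lambda>k\<in>K. r * z k) \<in> {z \<in> C. coord_norm K z \<le> r} \<longleftrightarrow> z \<in> C \<inter> punctured_ball K"
      using C r z by (auto simp: cone_set_def punctured_ball_def coord_norm_scale)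
    then show "indicator {z \<in> C. coord_norm K z \<le> r} (\<lambda>k\<in>K. r * z k) =
        (indicator (C \<inter> punctured_ball K) z :: ennreal)"
      by (simp add: indicator_def)
  qed
  also have "\<dots> = emeasure ?V (C \<inter> punctured_ball K)"
    using Cs punctured_ball_sets[OF fin] by (intro nn_integral_indicator) auto
  finally show ?thesis using r by simp
qed

text \<open>A radial weight that is a superposition of indicators of balls does not see the angular part
  of a cone.\<close>
lemma nn_integral_cone_radial:
  fixes \<rho> :: "real \<Rightarrow> real"
  assumes fin: "finite K" and C: "cone_set K C" and [measurable]: "\<rho> \<in> borel_measurable borel"
  shows "(\<integral>\<^sup>+z. indicator C z * (\<integral>\<^sup>+t. indicator {t. coord_norm K z \<le> \<rho> t} t \<partial>lborel) \<partial>(\<Pi>\<^sub>M k\<in>K. lborel)) =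
    (\<integral>\<^sup>+t. ennreal (max (\<rho> t) 0 ^ card K * indicator {0<..} (\<rho> t)) \<partial>lborel) *
      emeasure (\<Pi>\<^sub>M k\<in>K. (lborel :: real measure)) (C \<inter> punctured_ball K)"
proof -
  interpret product_sigma_finite "\<lambda>_::nat. (lborel :: real measure)" by standard
  let ?V = "\<Pi>\<^sub>M k\<in>K. (lborel :: real measure)"
  interpret V: sigma_finite_measure ?V by (rule sigma_finite[OF fin])
  interpret P: pair_sigma_finite ?V lborel ..
  have Cs[measurable]: "C \<in> sets ?V" using C by (simp add: cone_set_def)
  have sub: "C \<subseteq> K \<rightarrow>\<^sub>E UNIV" using sets.sets_into_space[OF Cs] by (simp add: space_PiM)
  have "(\<integral>\<^sup>+z. indicator C z * (\<integral>\<^sup>+t. indicator {t. coord_norm K z \<le> \<rho> t} t \<partial>lborel) \<partial>?V) =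
      (\<integral>\<^sup>+z. (\<integral>\<^sup>+t. indicator C z * indicator {t. coord_norm K z \<le> \<rho> t} t \<partial>lborel) \<partial>?V)"
    by (intro nn_integral_cong nn_integral_cmult[symmetric]) measurable
  also have "\<dots> = (\<integral>\<^sup>+t. (\<integral>\<^sup>+z. indicator C z * indicator {t. coord_norm K z \<le> \<rho> t} t \<partial>?V) \<partial>lborel)"
    by (rule P.Fubini'[symmetric]) measurable
  also have "\<dots> = (\<integral>\<^sup>+t. emeasure ?V {z \<in> C. coord_norm K z \<le> \<rho> t} \<partial>lborel)"
  proof (rule nn_integral_cong)
    fix t
    have eq: "{z \<in> C. coord_norm K z \<le> \<rho> t} = C \<inter> {z \<in> space ?V. coord_norm K z \<le> \<rho> t}"
      using sub by (auto simp: space_PiM)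
    have "(\<integral>\<^sup>+z. indicator C z * indicator {t. coord_norm K z \<le> \<rho> t} t \<partial>?V) =
        (\<integral>\<^sup>+z. indicator {z \<in> C. coord_norm K z \<le> \<rho> t} z \<partial>?V)"
      by (intro nn_integral_cong) (auto split: split_indicator)
    also have "\<dots> = emeasure ?V {z \<in> C. coord_norm K z \<le> \<rho> t}"
      unfolding eq by (rule nn_integral_indicator) measurable
    finally show "(\<integral>\<^sup>+z. indicator C z * indicator {t. coord_norm K z \<le> \<rho> t} t \<partial>?V) =
        emeasure ?V {z \<in> C. coord_norm K z \<le> \<rho> t}" .
  qed
  also have "\<dots> = (\<integral>\<^sup>+t. ennreal (max (\<rho> t) 0 ^ card K * indicator {0<..} (\<rho> t)) *
      emeasure ?V (C \<inter> punctured_ball K) \<partial>lborel)"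
    using fin C by (simp add: emeasure_cone_ball)
  also have "\<dots> = (\<integral>\<^sup>+t. ennreal (max (\<rho> t) 0 ^ card K * indicator {0<..} (\<rho> t)) \<partial>lborel) *
      emeasure ?V (C \<inter> punctured_ball K)"
    by (rule nn_integral_multc) measurable
  finally show ?thesis .
qed

text \<open>This covers t > 1 as well: the real \<open>sqrt\<close> is odd and increasing, so the
  radius is then negative and no positive s lies below it.\<close>

lemma exp_level_iff:
  fixes s t :: real
  assumes "s > 0"
  shows "0 < t \<and> t \<le> exp (- s\<^sup>2 / 2) \<longleftrightarrow> 0 < t \<and> s \<le> sqrt (- 2 * ln t)"
proof (cases "t > 0")
  case True
  have "t \<le> exp (- s\<^sup>2 / 2) \<longleftrightarrow> ln t \<le> - s\<^sup>2 / 2"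
    using True ln_le_cancel_iff[of t "exp (- s\<^sup>2 / 2)"] by simp
  also have "\<dots> \<longleftrightarrow> s\<^sup>2 \<le> - 2 * ln t" by auto
  also have "\<dots> \<longleftrightarrow> sqrt (s\<^sup>2) \<le> sqrt (- 2 * ln t)" by (simp only: real_sqrt_le_iff)
  finally show ?thesis using assms by simp
qed simp

text \<open>Layer-cake representation of exp(-|z|^2/2): the level set at t in (0, 1] is the ball of
  radius sqrt(-2 ln t). For t <= 0 the radius is set to 0, so that these t contribute nothing at a
  nonzero z.\<close>

lemma gauss_density_levels:
  assumes fin: "finite K" and z: "0 < coord_norm K z"
  shows "ennreal (\<Prod>k\<in>K. std_normal_density (z k)) = ennreal ((1 / sqrt (2 * pi)) ^ card K) *
    (\<integral>\<^sup>+t. indicator {t. coord_norm K z \<le> (if t > 0 then sqrt (- 2 * ln t) else 0)} t \<partial>lborel)"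
proof -
  have "(\<Prod>k\<in>K. std_normal_density (z k)) = (1 / sqrt (2 * pi)) ^ card K * exp (- (coord_norm K z)\<^sup>2 / 2)"
    using fin by (simp add: std_normal_density_def prod.distrib coord_norm_square
        sum_divide_distrib power_one_over prod_dividef flip: exp_sum sum_negf)
  moreover have "(\<integral>\<^sup>+t. indicator {t. coord_norm K z \<le> (if t > 0 then sqrt (- 2 * ln t) else 0)} t \<partial>lborel) =
      (\<integral>\<^sup>+t. indicator {0<..exp (- (coord_norm K z)\<^sup>2 / 2)} t \<partial>lborel)"
    using exp_level_iff[OF z] z
    by (intro nn_integral_cong) (auto split: split_indicator if_splits)
  ultimately show ?thesis by (simp add: ennreal_mult)
qed

text \<open>Independence of direction and radius, in a form without division. As a mixture of balls,
  the Gaussian gives a cone C the mass J vol(C cap B), with B the punctured unit ball and J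
  independent of C; comparing C with the cone of all nonzero vectors eliminates J. Truncation at
  radius r replaces the radii by their minimum with r.\<close>

lemma gauss_cone:
  assumes fin: "finite K" and C: "cone_set K C"
  shows "emeasure (gauss K) C * emeasure (\<Pi>\<^sub>M k\<in>K. lborel) (punctured_ball K) =
      emeasure (\<Pi>\<^sub>M k\<in>K. lborel) (C \<inter> punctured_ball K) * emeasure (gauss K) {z \<in> space (gauss K). 0 < coord_norm K z}"
    and "emeasure (gauss K) {z \<in> C. coord_norm K z \<le> r} * emeasure (\<Pi>\<^sub>M k\<in>K. lborel) (punctured_ball K) =
      emeasure (\<Pi>\<^sub>M k\<in>K. lborel) (C \<inter> punctured_ball K) *
        emeasure (gauss K) {z \<in> space (gauss K). 0 < coord_norm K z \<and> coord_norm K z \<le> r}"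
proof -
  let ?V = "\<Pi>\<^sub>M k\<in>K. (lborel :: real measure)" and ?B = "punctured_ball K"
  let ?D = "{z \<in> space (gauss K). 0 < coord_norm K z}"
  have spV: "space ?V = K \<rightarrow>\<^sub>E UNIV" by (simp add: space_PiM)
  have D: "cone_set K ?D"
    unfolding cone_set_def
  proof (intro conjI ballI allI impI)
    have "?D = {z \<in> space ?V. 0 < coord_norm K z}" by (simp add: spV)
    also have "\<dots> \<in> sets ?V" by measurable
    finally show "?D \<in> sets ?V" .
  qed (auto simp: coord_norm_scale zero_less_mult_iff)
  have DB: "?D \<inter> ?B = ?B" by (auto simp: punctured_ball_def)
  define \<rho> :: "real \<Rightarrow> real" where "\<rho> t = (if t > 0 then sqrt (- 2 * ln t) else 0)" for t
  define \<kappa> where "\<kappa> = ennreal ((1 / sqrt (2 * pi)) ^ card K)"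
  have [measurable]: "\<rho> \<in> borel_measurable borel" unfolding \<rho>_def[abs_def] by measurable
  \<comment> \<open>Stated for a general radius function so as to serve twice: X = C with
    \<open>\<rho>\<close> itself, and X the part of C of norm at most r with
    \<open>min r (\<rho> t)\<close>, whose balls miss the rest of C.\<close>
  have density: "emeasure (gauss K) X = (\<integral>\<^sup>+z. \<kappa> * (indicator C z *
      (\<integral>\<^sup>+t. indicator {t. coord_norm K z \<le> \<sigma> t} t \<partial>lborel)) \<partial>?V)"
    if C: "cone_set K C" and X[measurable]: "X \<in> sets ?V" and XC: "X \<subseteq> C"
      and \<sigma>: "\<And>z t. z \<in> X \<Longrightarrow> coord_norm K z \<le> \<sigma> t \<longleftrightarrow> coord_norm K z \<le> \<rho> t"
      "\<And>z t. z \<in> C - X \<Longrightarrow> \<not> coord_norm K z \<le> \<sigma> t" for C X and \<sigma> :: "real \<Rightarrow> real"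
  proof -
    have "emeasure (gauss K) X = (\<integral>\<^sup>+z. ennreal (\<Prod>k\<in>K. std_normal_density (z k)) * indicator X z \<partial>?V)"
      unfolding gauss_eq_density[OF fin] by (rule emeasure_density) measurable
    also have "\<dots> = (\<integral>\<^sup>+z. \<kappa> * (indicator C z *
      (\<integral>\<^sup>+t. indicator {t. coord_norm K z \<le> \<sigma> t} t \<partial>lborel)) \<partial>?V)"
    proof (rule nn_integral_cong)
      fix z
      consider "z \<in> X" | "z \<in> C - X" | "z \<notin> C" by auto
      then show "ennreal (\<Prod>k\<in>K. std_normal_density (z k)) * indicator X z =
          \<kappa> * (indicator C z * (\<integral>\<^sup>+t. indicator {t. coord_norm K z \<le> \<sigma> t} t \<partial>lborel))"
      proof cases
        case 1
        then have "0 < coord_norm K z" using C XC by (auto simp: cone_set_def)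
        from gauss_density_levels[OF fin this] show ?thesis
          using 1 XC \<sigma>(1)[OF 1] by (auto simp: \<kappa>_def \<rho>_def)
      next
        case 2
        then show ?thesis using \<sigma>(2)[OF 2] by simp
      next
        case 3
        then show ?thesis using XC by (auto split: split_indicator)
      qed
    qed
    finally show ?thesis .
  qed
  \<comment> \<open>The order of the quantifiers matters: J depends on the radii and not on the
    cone.\<close>
  have cone: "\<exists>J. \<forall>C. cone_set K C \<longrightarrow> (\<integral>\<^sup>+z. \<kappa> * (indicator C z *
      (\<integral>\<^sup>+t. indicator {t. coord_norm K z \<le> \<sigma> t} t \<partial>lborel)) \<partial>?V) = J * emeasure ?V (C \<inter> ?B)"
    if [measurable]: "\<sigma> \<in> borel_measurable borel" for \<sigma> :: "real \<Rightarrow> real"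
  proof (intro exI allI impI)
    fix C assume C: "cone_set K C"
    interpret product_sigma_finite "\<lambda>_::nat. (lborel :: real measure)" by standard
    have [measurable]: "C \<in> sets ?V" using C by (simp add: cone_set_def)
    have "(\<integral>\<^sup>+z. \<kappa> * (indicator C z * (\<integral>\<^sup>+t. indicator {t. coord_norm K z \<le> \<sigma> t} t \<partial>lborel)) \<partial>?V) =
      \<kappa> * (\<integral>\<^sup>+z. indicator C z * (\<integral>\<^sup>+t. indicator {t. coord_norm K z \<le> \<sigma> t} t \<partial>lborel) \<partial>?V)"
      by (rule nn_integral_cmult) measurable
    then show "(\<integral>\<^sup>+z. \<kappa> * (indicator C z * (\<integral>\<^sup>+t. indicator {t. coord_norm K z \<le> \<sigma> t} t \<partial>lborel)) \<partial>?V) =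
      (\<kappa> * (\<integral>\<^sup>+t. ennreal (max (\<sigma> t) 0 ^ card K * indicator {0<..} (\<sigma> t)) \<partial>lborel)) * emeasure ?V (C \<inter> ?B)"
      by (simp only: nn_integral_cone_radial[OF fin C that] mult.assoc)
  qed
  have sets: "C \<in> sets ?V" if "cone_set K C" for C using that by (simp add: cone_set_def)
  have "\<exists>J. \<forall>C. cone_set K C \<longrightarrow> emeasure (gauss K) C = J * emeasure ?V (C \<inter> ?B)"
  proof -
    obtain J where "\<forall>C. cone_set K C \<longrightarrow> (\<integral>\<^sup>+z. \<kappa> * (indicator C z *
      (\<integral>\<^sup>+t. indicator {t. coord_norm K z \<le> \<rho> t} t \<partial>lborel)) \<partial>?V) = J * emeasure ?V (C \<inter> ?B)"
      using cone[of \<rho>] by auto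
    then show ?thesis using density[of C C \<rho> for C] sets by (intro exI[of _ J]) auto
  qed
  then show "emeasure (gauss K) C * emeasure ?V ?B = emeasure ?V (C \<inter> ?B) * emeasure (gauss K) ?D"
    using C D by (auto simp: DB[unfolded space_gauss] mult_ac)
  let ?ball = "\<lambda>C. {z \<in> C. coord_norm K z \<le> r}"
  have "\<exists>J. \<forall>C. cone_set K C \<longrightarrow> emeasure (gauss K) (?ball C) = J * emeasure ?V (C \<inter> ?B)"
  proof -
    obtain J where J: "\<forall>C. cone_set K C \<longrightarrow> (\<integral>\<^sup>+z. \<kappa> * (indicator C z *
      (\<integral>\<^sup>+t. indicator {t. coord_norm K z \<le> min r (\<rho> t)} t \<partial>lborel)) \<partial>?V) = J * emeasure ?V (C \<inter> ?B)"
      using cone[of "\<lambda>t. min r (\<rho> t)"] by auto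
    have "emeasure (gauss K) (?ball C) = J * emeasure ?V (C \<inter> ?B)" if C: "cone_set K C" for C
    proof -
      have [measurable]: "C \<in> sets ?V" using C by (rule sets)
      have "?ball C = C \<inter> {z \<in> space ?V. coord_norm K z \<le> r}"
        using sets.sets_into_space[OF sets[OF C]] by auto
      also have "\<dots> \<in> sets ?V" by measurable
      finally show ?thesis using J C density[OF C, of "?ball C" "\<lambda>t. min r (\<rho> t)"] by auto
    qed
    then show ?thesis by blast
  qed
  then obtain J where J: "\<And>C. cone_set K C \<Longrightarrow> emeasure (gauss K) (?ball C) = J * emeasure ?V (C \<inter> ?B)"
    by blast
  have "?ball ?D = {z \<in> space (gauss K). 0 < coord_norm K z \<and> coord_norm K z \<le> r}" by auto
  then show "emeasure (gauss K) (?ball C) * emeasure ?V ?B = emeasure ?V (C \<inter> ?B) *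
        emeasure (gauss K) {z \<in> space (gauss K). 0 < coord_norm K z \<and> coord_norm K z \<le> r}"
    using J[OF C] J[OF D] DB by (simp only: mult_ac)
qed

text \<open>The difference of the two identities of \<open>gauss_cone\<close>. The subtraction is
  why it is stated with the real-valued \<open>measure\<close>.\<close>

lemma gauss_cone_outside_ball:
  assumes fin: "finite K" and C: "cone_set K C" and r: "r \<ge> 0"
  shows "measure (gauss K) {z \<in> C. r < coord_norm K z} * measure (\<Pi>\<^sub>M k\<in>K. lborel) (punctured_ball K) =
    measure (\<Pi>\<^sub>M k\<in>K. lborel) (C \<inter> punctured_ball K) *
      measure (gauss K) {z \<in> space (gauss K). r < coord_norm K z}"
proof -
  interpret prob_space "gauss K" by (rule prob_space_gauss)
  let ?V = "\<Pi>\<^sub>M k\<in>K. (lborel :: real measure)" and ?B = "punctured_ball K"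
  let ?D = "{z \<in> space (gauss K). 0 < coord_norm K z}"
  have [measurable]: "coord_norm K \<in> borel_measurable (gauss K)"
    using coord_norm_measurable by (simp add: measurable_cong_sets[OF sets_gauss refl])
  have Cm[measurable]: "C \<in> events" using C by (simp add: cone_set_def sets_gauss)
  have out: "measure (gauss K) {z \<in> A. r < coord_norm K z} =
      measure (gauss K) A - measure (gauss K) {z \<in> A. coord_norm K z \<le> r}" if [measurable]: "A \<in> events" for A
  proof -
    have eq: "{z \<in> A. coord_norm K z \<le> r} = A \<inter> {z \<in> space (gauss K). coord_norm K z \<le> r}"
      using sets.sets_into_space[OF that] by auto
    have [measurable]: "{z \<in> A. coord_norm K z \<le> r} \<in> events" unfolding eq by measurable
    have "{z \<in> A. r < coord_norm K z} = A - {z \<in> A. coord_norm K z \<le> r}" by auto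
    also have "measure (gauss K) \<dots> = measure (gauss K) A - measure (gauss K) {z \<in> A. coord_norm K z \<le> r}"
      by (intro finite_measure_Diff) auto
    finally show ?thesis .
  qed
  have D: "?D \<in> events" by measurable
  have "measure (gauss K) C * measure ?V ?B = measure ?V (C \<inter> ?B) * measure (gauss K) ?D"
    using arg_cong[OF gauss_cone(1)[OF fin C], of enn2real] by (simp add: measure_def enn2real_mult)
  moreover have "measure (gauss K) {z \<in> C. coord_norm K z \<le> r} * measure ?V ?B =
      measure ?V (C \<inter> ?B) * measure (gauss K) {z \<in> ?D. coord_norm K z \<le> r}"
    using arg_cong[OF gauss_cone(2)[OF fin C, of r], of enn2real]
    by (simp add: measure_def enn2real_mult conj_assoc)
  moreover have "{z \<in> space (gauss K). r < coord_norm K z} = {z \<in> ?D. r < coord_norm K z}"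
    using r by auto
  ultimately show ?thesis by (simp only: out[OF Cm] out[OF D]) (simp add: algebra_simps)
qed

section \<open>Norms of a random vector of a subspace\<close>

lemma powr_convex_combination:
  fixes a b l q :: real
  assumes "a \<ge> 0" "b \<ge> 0" "0 \<le> l" "l \<le> 1" "q \<ge> 1"
  shows "(l * a + (1 - l) * b) powr q \<le> l * a powr q + (1 - l) * b powr q"
proof -
  \<comment> \<open>Convexity is used on the open half-line; when a or b is 0 only one summand
    remains, and t^q <= t on [0, 1] suffices.\<close>
  have small: "(t * x) powr q \<le> t * x powr q" if "0 \<le> t" "t \<le> 1" "x \<ge> 0" for t x :: real
  proof -
    have "t powr q \<le> t" using powr_mono'[of 1 q t] that assms(5) by simp
    then show ?thesis using that by (simp add: powr_mult mult_right_mono)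
  qed
  consider "a = 0" | "b = 0" | "a > 0" "b > 0" using assms by linarith
  then show ?thesis
  proof cases
    case 1
    then show ?thesis using small[of "1 - l" b] assms by simp
  next
    case 2
    then show ?thesis using small[of l a] assms by simp
  next
    case 3
    then show ?thesis
      using convex_onD[OF powr_convex[OF assms(5)], of "1 - l" a b] assms by simp
  qed
qed

text \<open>\<open>Lq_norm\<close> for coordinate functions, which keeps the analysis free of vector
  dimensions and carrier conditions.\<close>

definition lq :: "real \<Rightarrow> nat \<Rightarrow> (nat \<Rightarrow> real) \<Rightarrow> real" where
  "lq q n x = (\<Sum>i<n. \<bar>x i\<bar> powr q) powr (1 / q)"

lemma lq_nonneg: "0 \<le> lq q n x"
  by (simp add: lq_def)

lemma lq_powr:
  assumes "q > 0"
  shows "lq q n x powr q = (\<Sum>i<n. \<bar>x i\<bar> powr q)"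
  using assms by (simp add: lq_def powr_powr sum_nonneg)

lemma lq_le_iff:
  assumes "q > 0" "M \<ge> 0"
  shows "lq q n x \<le> M \<longleftrightarrow> (\<Sum>i<n. \<bar>x i\<bar> powr q) \<le> M powr q"
proof
  assume "lq q n x \<le> M"
  then have "lq q n x powr q \<le> M powr q" using assms lq_nonneg by (intro powr_mono2) auto
  then show "(\<Sum>i<n. \<bar>x i\<bar> powr q) \<le> M powr q" using assms by (simp add: lq_powr)
next
  assume "(\<Sum>i<n. \<bar>x i\<bar> powr q) \<le> M powr q"
  then have "lq q n x \<le> (M powr q) powr (1 / q)"
    unfolding lq_def using assms by (intro powr_mono2) (auto simp: sum_nonneg)
  then show "lq q n x \<le> M" using assms by (simp add: powr_powr)
qed

lemma lq_scale:
  assumes "q > 0" "c \<ge> 0"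
  shows "lq q n (\<lambda>i. c * x i) = c * lq q n x"
proof -
  have "(\<Sum>i<n. \<bar>c * x i\<bar> powr q) = c powr q * (\<Sum>i<n. \<bar>x i\<bar> powr q)"
    using assms by (simp add: abs_mult powr_mult sum_distrib_left)
  then show ?thesis using assms by (simp add: lq_def powr_mult powr_powr sum_nonneg)
qed

text \<open>Minkowski's inequality by normalisation: with X and Y the two norms, |x| + |y| is X + Y
  times the convex combination of |x|/X and |y|/Y with weights X/(X + Y) and Y/(X + Y). Convexity of
  the power applies coordinatewise, and each normalised power sum is 1.\<close>

lemma lq_triangle:
  assumes q: "q \<ge> 1"
  shows "lq q n (\<lambda>i. x i + y i) \<le> lq q n x + lq q n y"
proof -
  let ?X = "lq q n x" and ?Y = "lq q n y"
  have zero: "w i = 0" if "lq q n w = 0" "i < n" for w i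
  proof -
    have "\<bar>w i\<bar> powr q \<le> (\<Sum>i<n. \<bar>w i\<bar> powr q)" using that by (intro member_le_sum) auto
    also have "\<dots> = 0" using lq_powr[of q n w] that(1) q by simp
    finally show ?thesis by (simp add: powr_nonneg_iff)
  qed
  have nonneg: "0 \<le> ?X" "0 \<le> ?Y" by (rule lq_nonneg)+
  consider "?X = 0" | "?Y = 0" | "?X \<noteq> 0" "?Y \<noteq> 0" by blast
  then show ?thesis
  proof cases
    case 1
    then have "(\<Sum>i<n. \<bar>x i + y i\<bar> powr q) = (\<Sum>i<n. \<bar>y i\<bar> powr q)"
      using zero[OF 1] by (intro sum.cong) auto
    then have "lq q n (\<lambda>i. x i + y i) = ?Y" by (simp only: lq_def)
    then show ?thesis using 1 by simp
  next
    case 2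
    then have "(\<Sum>i<n. \<bar>x i + y i\<bar> powr q) = (\<Sum>i<n. \<bar>x i\<bar> powr q)"
      using zero[OF 2] by (intro sum.cong) auto
    then have "lq q n (\<lambda>i. x i + y i) = ?X" by (simp only: lq_def)
    then show ?thesis using 2 by simp
  next
    case 3
    then have 3: "?X > 0" "?Y > 0" using nonneg by simp_all
    define l where "l = ?X / (?X + ?Y)"
    have l: "0 \<le> l" "l \<le> 1" "1 - l = ?Y / (?X + ?Y)" using 3 by (auto simp: l_def field_simps)
    have "(\<Sum>i<n. \<bar>x i + y i\<bar> powr q) \<le>
        (\<Sum>i<n. (?X + ?Y) powr q * (l * (\<bar>x i\<bar> / ?X) powr q + (1 - l) * (\<bar>y i\<bar> / ?Y) powr q))"
    proof (rule sum_mono)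
      fix i
      have "\<bar>x i\<bar> + \<bar>y i\<bar> = (?X + ?Y) * (l * (\<bar>x i\<bar> / ?X) + (1 - l) * (\<bar>y i\<bar> / ?Y))"
        using 3 unfolding l(3) by (simp add: l_def distrib_left)
      moreover have "\<bar>x i + y i\<bar> powr q \<le> (\<bar>x i\<bar> + \<bar>y i\<bar>) powr q"
        using q by (intro powr_mono2) auto
      ultimately have "\<bar>x i + y i\<bar> powr q \<le>
          ((?X + ?Y) * (l * (\<bar>x i\<bar> / ?X) + (1 - l) * (\<bar>y i\<bar> / ?Y))) powr q"
        by (simp only:)
      also have "\<dots> = (?X + ?Y) powr q * (l * (\<bar>x i\<bar> / ?X) + (1 - l) * (\<bar>y i\<bar> / ?Y)) powr q"
        by (rule powr_mult)
      also have "\<dots> \<le> (?X + ?Y) powr q * (l * (\<bar>x i\<bar> / ?X) powr q + (1 - l) * (\<bar>y i\<bar> / ?Y) powr q)"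
        using 3 l q by (intro mult_left_mono powr_convex_combination) auto
      finally show "\<bar>x i + y i\<bar> powr q \<le>
          (?X + ?Y) powr q * (l * (\<bar>x i\<bar> / ?X) powr q + (1 - l) * (\<bar>y i\<bar> / ?Y) powr q)" .
    qed
    also have "\<dots> = (?X + ?Y) powr q * (l * ((\<Sum>i<n. \<bar>x i\<bar> powr q) / ?X powr q) +
        (1 - l) * ((\<Sum>i<n. \<bar>y i\<bar> powr q) / ?Y powr q))"
      using 3 by (simp add: powr_divide sum_divide_distrib sum.distrib flip: sum_distrib_left times_divide_eq_right)
    also have "\<dots> = (?X + ?Y) powr q"
      using 3 q by (simp flip: lq_powr)
    finally show ?thesis using q 3 by (subst lq_le_iff) auto
  qed
qed

text \<open>Write |x_i|^q = x_i^2 |x_i|^(q - 2) and bound the last factor through |x_i| <=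
  |x|_2.\<close>

lemma lq_le_l2:
  assumes q: "q \<ge> 2"
  shows "lq q n x \<le> sqrt (\<Sum>i<n. (x i)\<^sup>2)"
proof -
  define S where "S = (\<Sum>i<n. (x i)\<^sup>2)"
  have S: "S \<ge> 0" by (simp add: S_def sum_nonneg)
  have le: "\<bar>x i\<bar> \<le> sqrt S" if "i < n" for i
  proof -
    have "(x i)\<^sup>2 \<le> S" unfolding S_def using that by (intro member_le_sum) auto
    then show ?thesis by (rule real_le_rsqrt[of "\<bar>x i\<bar>", simplified])
  qed
  have "(\<Sum>i<n. \<bar>x i\<bar> powr q) \<le> (\<Sum>i<n. (x i)\<^sup>2 * sqrt S powr (q - 2))"
  proof (rule sum_mono)
    fix i assume i: "i \<in> {..<n}"
    have "\<bar>x i\<bar> powr q = \<bar>x i\<bar> powr 2 * \<bar>x i\<bar> powr (q - 2)"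
      using powr_add[of "\<bar>x i\<bar>" 2 "q - 2"] by simp
    also have "\<dots> \<le> (x i)\<^sup>2 * sqrt S powr (q - 2)"
      using le[of i] i q by (auto simp: powr_numeral intro!: mult_left_mono powr_mono2)
    finally show "\<bar>x i\<bar> powr q \<le> (x i)\<^sup>2 * sqrt S powr (q - 2)" .
  qed
  also have "\<dots> = sqrt S powr 2 * sqrt S powr (q - 2)"
    using S by (simp add: S_def powr_numeral flip: sum_distrib_right)
  also have "\<dots> = sqrt S powr q" by (simp flip: powr_add)
  finally show ?thesis using q S unfolding S_def[symmetric] by (subst lq_le_iff) auto
qed

text \<open>Here \<open>b k i\<close> stands for coordinate i of the k-th basis vector. The isometry
  is all that the estimates use of orthonormality; matrix and spectrum disappear from the
  analysis.\<close>

locale coordinate_isometry =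
  fixes n :: nat and K :: "nat set" and b :: "nat \<Rightarrow> nat \<Rightarrow> real"
  assumes fin: "finite K" and ne: "K \<noteq> {}"
    and isometry: "\<And>z. (\<Sum>i<n. (\<Sum>k\<in>K. z k * b k i)\<^sup>2) = (\<Sum>k\<in>K. (z k)\<^sup>2)"
begin

definition comb :: "(nat \<Rightarrow> real) \<Rightarrow> nat \<Rightarrow> real" where
  "comb z i = (\<Sum>k\<in>K. z k * b k i)"

definition comb_norm :: "real \<Rightarrow> (nat \<Rightarrow> real) \<Rightarrow> real" where
  "comb_norm q z = lq q n (comb z)"

section \<open>Coordinate variances, and the Gaussian estimates they give\<close>

lemma column_norm:
  assumes "k \<in> K"
  shows "(\<Sum>i<n. (b k i)\<^sup>2) = 1"
  using isometry[of "\<lambda>j. if j = k then 1 else 0"] assms fin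
  by (simp add: if_distrib if_distribR cong: if_cong)

text \<open>The trace of the orthogonal projection onto the range of \<open>comb\<close> equals its
  rank; the inner sums are its diagonal entries, the variances of the coordinates.\<close>

lemma row_norm_sum: "(\<Sum>i<n. \<Sum>k\<in>K. (b k i)\<^sup>2) = card K"
  by (subst sum.swap) (simp add: column_norm)

text \<open>For the projection matrix p, the isometry applied to row i of b says that the sum of
  p_ij^2 over j is p_ii; hence p_ii^2 <= p_ii.\<close>

lemma row_norm_le:
  assumes "i < n"
  shows "(\<Sum>k\<in>K. (b k i)\<^sup>2) \<le> 1"
proof -
  let ?a = "\<Sum>k\<in>K. (b k i)\<^sup>2"
  have "?a\<^sup>2 = (\<Sum>k\<in>K. b k i * b k i)\<^sup>2" by (simp add: power2_eq_square)
  also have "\<dots> \<le> (\<Sum>j<n. (\<Sum>k\<in>K. b k i * b k j)\<^sup>2)"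
    using assms member_le_sum[of i "{..<n}" "\<lambda>j. (\<Sum>k\<in>K. b k i * b k j)\<^sup>2"] by auto
  also have "\<dots> = ?a" by (rule isometry)
  finally have "?a * ?a \<le> 1 * ?a" by (simp add: power2_eq_square)
  moreover have "?a \<ge> 0" by (simp add: sum_nonneg)
  ultimately show ?thesis by (cases "?a = 0") (auto simp: mult_le_cancel_right)
qed

lemma comb_measurable [measurable]: "(\<lambda>z. comb z i) \<in> borel_measurable (\<Pi>\<^sub>M k\<in>K. (lborel :: real measure))"
  unfolding comb_def by measurable

lemma comb_scale: "comb (\<lambda>k\<in>K. c * z k) i = c * comb z i"
  by (simp add: comb_def sum_distrib_left mult.assoc)

lemma comb_norm_measurable [measurable]:
  "comb_norm q \<in> borel_measurable (\<Pi>\<^sub>M k\<in>K. (lborel :: real measure))"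
  unfolding comb_norm_def lq_def by measurable

text \<open>For q >= 2 the l^q norm is dominated by the Euclidean norm with constant 1, whatever n
  is, and the isometry carries this back to the coordinates z.\<close>

lemma lq_lipschitz:
  assumes q: "q \<ge> 2"
  shows "comb_norm q z - comb_norm q y \<le> sqrt (\<Sum>k\<in>K. (y k - z k)\<^sup>2)"
proof -
  have split: "comb z = (\<lambda>i. comb (\<lambda>k. z k - y k) i + comb y i)"
    by (auto simp: fun_eq_iff comb_def left_diff_distrib sum_subtractf)
  have "comb_norm q z \<le> lq q n (comb (\<lambda>k. z k - y k)) + comb_norm q y"
    unfolding comb_norm_def using q by (subst split) (rule lq_triangle, simp)
  also have "lq q n (comb (\<lambda>k. z k - y k)) \<le> sqrt (\<Sum>i<n. (comb (\<lambda>k. z k - y k) i)\<^sup>2)"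
    using q by (rule lq_le_l2)
  also have "(\<Sum>i<n. (comb (\<lambda>k. z k - y k) i)\<^sup>2) = (\<Sum>k\<in>K. (y k - z k)\<^sup>2)"
    unfolding comb_def by (simp add: isometry power2_commute)
  finally show ?thesis by simp
qed

text \<open>The variances a_i lie in [0, 1] and q/2 >= 1, so a_i^(q/2) <= a_i; summing over i then
  produces the rank \<open>card K\<close> instead of the ambient dimension n.\<close>

lemma gauss_lq_moment:
  assumes q: "q \<ge> 2"
  shows "(\<integral>\<^sup>+z. ennreal (\<Sum>i<n. \<bar>comb z i\<bar> powr q) \<partial>gauss K) \<le> ennreal (2 * card K * q powr (q / 2))"
proof -
  let ?a = "\<lambda>i. \<Sum>k\<in>K. (b k i)\<^sup>2"
  have "(\<integral>\<^sup>+z. ennreal (\<Sum>i<n. \<bar>comb z i\<bar> powr q) \<partial>gauss K) =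
      (\<Sum>i<n. \<integral>\<^sup>+z. ennreal (\<bar>comb z i\<bar> powr q) \<partial>gauss K)"
    by (simp add: nn_integral_sum flip: sum_ennreal)
  also have "\<dots> \<le> (\<Sum>i<n. ennreal (2 * q powr (q / 2) * ?a i))"
  proof (rule sum_mono)
    fix i assume i: "i \<in> {..<n}"
    have a: "0 \<le> ?a i" "?a i \<le> 1" using row_norm_le i by (auto simp: sum_nonneg)
    have "(\<integral>\<^sup>+z. ennreal (\<bar>comb z i\<bar> powr q) \<partial>gauss K) \<le> ennreal (2 * (q * ?a i) powr (q / 2))"
      using gauss_abs_linear_moment[OF fin, of q "\<lambda>k. b k i"] q by (simp add: comb_def mult.commute)
    also have "(q * ?a i) powr (q / 2) = q powr (q / 2) * ?a i powr (q / 2)"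
      by (rule powr_mult)
    also have "?a i powr (q / 2) \<le> ?a i" using powr_mono'[of 1 "q / 2" "?a i"] a q by simp
    finally show "(\<integral>\<^sup>+z. ennreal (\<bar>comb z i\<bar> powr q) \<partial>gauss K) \<le> ennreal (2 * q powr (q / 2) * ?a i)"
      by (simp add: ennreal_leI mult_left_mono mult.assoc)
  qed
  also have "\<dots> = ennreal (\<Sum>i<n. 2 * q powr (q / 2) * ?a i)"
    by (rule sum_ennreal) (simp add: sum_nonneg)
  also have "(\<Sum>i<n. 2 * q powr (q / 2) * ?a i) = 2 * card K * q powr (q / 2)"
    by (simp add: row_norm_sum flip: sum_distrib_left)
  finally show ?thesis .
qed

text \<open>With T = N q^(q/2) the q-th moment is at most 2T, and Markov's inequality is applied at
  4T. The factor 2 in the threshold provides 2^q >= 4 after taking q-th powers.\<close>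

lemma gauss_lq_median:
  assumes q: "q \<ge> 2"
  shows "measure (gauss K) {z \<in> space (gauss K). comb_norm q z \<le> 2 * sqrt q * card K powr (1 / q)} \<ge> 1 / 2"
proof -
  interpret prob_space "gauss K" by (rule prob_space_gauss)
  let ?N = "real (card K)"
  let ?M = "2 * sqrt q * ?N powr (1 / q)" and ?f = "\<lambda>z. \<Sum>i<n. \<bar>comb z i\<bar> powr q"
  have N: "?N \<ge> 1" using fin ne by (simp add: Suc_le_eq card_gt_0_iff)
  define T where "T = ?N * q powr (q / 2)"
  have T: "T > 0" using N q by (simp add: T_def)
  have [measurable]: "?f \<in> borel_measurable (gauss K)" by measurable
  have "4 * T \<le> ?M powr q"
  proof -
    have "?M powr q = 2 powr q * sqrt q powr q * ?N" using q N by (simp add: powr_mult powr_powr)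
    moreover have "sqrt q powr q = q powr (q / 2)" using q by (simp add: powr_half_sqrt[symmetric] powr_powr)
    moreover have "(2 :: real) powr 2 \<le> 2 powr q" using q by (intro powr_mono) auto
    ultimately have "?M powr q = 2 powr q * T" "4 \<le> (2 :: real) powr q" by (simp_all add: T_def mult_ac)
    then show ?thesis using T by (simp add: mult_right_mono)
  qed
  then have sub: "comb_norm q z \<le> ?M" if "?f z \<le> 4 * T" for z
    unfolding comb_norm_def using that q by (subst lq_le_iff) auto
  have "emeasure (gauss K) {z \<in> space (gauss K). 1 \<le> ennreal (1 / (4 * T)) * ennreal (?f z)} \<le>
      ennreal (1 / (4 * T)) * (\<integral>\<^sup>+z. ennreal (?f z) * indicator (space (gauss K)) z \<partial>gauss K)"
    by (rule nn_integral_Markov_inequality) measurable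
  also have "(\<integral>\<^sup>+z. ennreal (?f z) * indicator (space (gauss K)) z \<partial>gauss K) = (\<integral>\<^sup>+z. ennreal (?f z) \<partial>gauss K)"
    by (intro nn_integral_cong) simp
  also have "\<dots> \<le> ennreal (2 * T)"
    using gauss_lq_moment[OF q] by (simp add: T_def mult.assoc)
  also have "ennreal (1 / (4 * T)) * ennreal (2 * T) = ennreal (1 / 2)"
    using T by (simp flip: ennreal_mult)
  finally have "measure (gauss K) {z \<in> space (gauss K). 1 \<le> ennreal (1 / (4 * T)) * ennreal (?f z)} \<le> 1 / 2"
    by (simp only: emeasure_eq_measure mult_left_mono zero_le ennreal_le_iff)
  also have "{z \<in> space (gauss K). 1 \<le> ennreal (1 / (4 * T)) * ennreal (?f z)} =
      {z \<in> space (gauss K). 4 * T \<le> ?f z}"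
    using T by (intro Collect_cong conj_cong refl) (simp add: sum_nonneg field_simps flip: ennreal_mult ennreal_1)
  finally have "measure (gauss K) {z \<in> space (gauss K). 4 * T \<le> ?f z} \<le> 1 / 2" .
  moreover have "measure (gauss K) {z \<in> space (gauss K). \<not> 4 * T \<le> ?f z} =
      1 - measure (gauss K) {z \<in> space (gauss K). 4 * T \<le> ?f z}"
    by (rule prob_neg) measurable
  moreover have "measure (gauss K) {z \<in> space (gauss K). \<not> 4 * T \<le> ?f z} \<le>
      measure (gauss K) {z \<in> space (gauss K). comb_norm q z \<le> ?M}"
  proof (rule finite_measure_mono)
    show "{z \<in> space (gauss K). comb_norm q z \<le> ?M} \<in> events" by measurable
  qed (use sub in auto)
  ultimately show ?thesis by linarith
qed

lemma cone_set_lq: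
  assumes "q > 0"
  shows "cone_set K {z \<in> K \<rightarrow>\<^sub>E UNIV. 0 < coord_norm K z \<and> s * coord_norm K z \<le> comb_norm q z}"
  unfolding cone_set_def
proof (intro conjI allI impI ballI)
  have "{z \<in> K \<rightarrow>\<^sub>E UNIV. 0 < coord_norm K z \<and> s * coord_norm K z \<le> comb_norm q z} =
    {z \<in> space (\<Pi>\<^sub>M k\<in>K. (lborel :: real measure)). 0 < coord_norm K z \<and> s * coord_norm K z \<le> comb_norm q z}"
    by (simp add: space_PiM)
  also have "\<dots> \<in> sets (\<Pi>\<^sub>M k\<in>K. lborel)"
    by (intro sets.sets_Collect_conj borel_measurable_le borel_measurable_less borel_measurable_times
        borel_measurable_const coord_norm_measurable comb_norm_measurable)
  finally show "{z \<in> K \<rightarrow>\<^sub>E UNIV. 0 < coord_norm K z \<and> s * coord_norm K z \<le> comb_norm q z}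
    \<in> sets (\<Pi>\<^sub>M k\<in>K. lborel)" .
  fix c :: real and z :: "nat \<Rightarrow> real" assume c: "c > 0" and z: "z \<in> K \<rightarrow>\<^sub>E UNIV"
  have "s * (c * coord_norm K z) \<le> c * comb_norm q z \<longleftrightarrow> s * coord_norm K z \<le> comb_norm q z"
    using c by (simp add: mult.left_commute)
  moreover have "comb_norm q (\<lambda>k\<in>K. c * z k) = c * comb_norm q z"
    using lq_scale[of q c n "comb z"] assms c by (simp add: comb_norm_def comb_scale lq_def)
  ultimately show "(\<lambda>k\<in>K. c * z k) \<in> {z \<in> K \<rightarrow>\<^sub>E UNIV. 0 < coord_norm K z \<and> s * coord_norm K z \<le> comb_norm q z}
      \<longleftrightarrow> z \<in> {z \<in> K \<rightarrow>\<^sub>E UNIV. 0 < coord_norm K z \<and> s * coord_norm K z \<le> comb_norm q z}"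
    using c z by (simp add: coord_norm_scale zero_less_mult_iff)
qed auto

text \<open>The cone of directions with norm at least s, cut to radii above r, lies at distance at
  least d from the set where the norm is at most its median bound M. Concentration bounds the
  Gaussian mass of this truncated cone; independence turns that into its share of the ball.\<close>

lemma ball_lq_tail:
  assumes q: "q \<ge> 2" and s: "s \<ge> 60 * sqrt q * card K powr (1 / q - 1 / 2)"
  shows "measure (\<Pi>\<^sub>M k\<in>K. lborel)
      ({z \<in> K \<rightarrow>\<^sub>E UNIV. 0 < coord_norm K z \<and> s * coord_norm K z \<le> comb_norm q z} \<inter> punctured_ball K)
    \<le> 4 * exp (- (1 / 8) * s\<^sup>2 * card K) * measure (\<Pi>\<^sub>M k\<in>K. lborel) (punctured_ball K)"
proof -
  interpret prob_space "gauss K" by (rule prob_space_gauss)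
  let ?V = "\<Pi>\<^sub>M k\<in>K. (lborel :: real measure)" and ?N = "real (card K)"
  let ?C = "{z \<in> K \<rightarrow>\<^sub>E UNIV. 0 < coord_norm K z \<and> s * coord_norm K z \<le> comb_norm q z}"
  define M where "M = 2 * sqrt q * ?N powr (1 / q)"
  define r where "r = sqrt (3 / 4 * ?N)"
  define S where "S = s * sqrt ?N"
  define d where "d = s * r - M"
  have N: "?N \<ge> 1" using fin ne by (simp add: Suc_le_eq card_gt_0_iff)
  have M2: "M \<ge> 2"
  proof -
    have "sqrt q \<ge> 1" using q by simp
    moreover have "?N powr (1 / q) \<ge> 1" using N q by (intro ge_one_powr_ge_zero) auto
    ultimately have "1 * 1 \<le> sqrt q * ?N powr (1 / q)" by (intro mult_mono) auto
    then show ?thesis by (simp add: M_def)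
  qed
  \<comment> \<open>Multiplying N^(1/q - 1/2) by sqrt N gives N^(1/q), so the constant 60 is 30
    times the 2 in M.\<close>
  have SM: "S \<ge> 30 * M"
  proof -
    have "?N powr (1 / q) = ?N powr (1 / q - 1 / 2) * sqrt ?N"
      using N by (simp add: powr_half_sqrt[symmetric] flip: powr_add)
    then have "30 * M = 60 * sqrt q * ?N powr (1 / q - 1 / 2) * sqrt ?N" by (simp add: M_def)
    also have "\<dots> \<le> s * sqrt ?N" using s by (intro mult_right_mono) auto
    finally show ?thesis by (simp add: S_def)
  qed
  have s0: "s \<ge> 0" using s by (rule order.trans[rotated]) (use q in simp)
  \<comment> \<open>From sqrt(3/4) >= 17/20 and M <= S/30, d is at least (17/20 - 1/30) S = 49 S /
    60.\<close>
  have d: "d \<ge> 4 / 5 * S"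
  proof -
    have "17 / 20 \<le> sqrt (3 / 4 :: real)" by (rule real_le_rsqrt) (simp add: power2_eq_square)
    then have "S * (17 / 20) \<le> S * sqrt (3 / 4)" using SM M2 by (intro mult_left_mono) auto
    moreover have "s * r = S * sqrt (3 / 4)" by (simp only: r_def S_def real_sqrt_mult mult_ac)
    ultimately have "17 / 20 * S \<le> s * r" by simp
    then show ?thesis using SM M2 unfolding d_def by linarith
  qed
  let ?A = "{z \<in> space (gauss K). comb_norm q z \<le> M}" and ?B = "{z \<in> ?C. r < coord_norm K z}"
  have [measurable]: "coord_norm K \<in> borel_measurable (gauss K)"
    "comb_norm q \<in> borel_measurable (gauss K)"
    by (simp_all add: measurable_cong_sets[OF sets_gauss refl] coord_norm_measurable comb_norm_measurable)
  have A: "?A \<in> events" by measurable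
  have C: "cone_set K ?C" using q by (intro cone_set_lq) simp
  then have Cs: "?C \<in> events" by (simp add: cone_set_def sets_gauss)
  have "?B = ?C \<inter> {z \<in> space (gauss K). r < coord_norm K z}" by auto
  also have "\<dots> \<in> events" using Cs by (rule sets.Int) measurable
  finally have B: "?B \<in> events" .
  have "measure (gauss K) ?A * measure (gauss K) ?B \<le> exp (- d\<^sup>2 / 4)"
  proof (rule gauss_separated_sets[OF fin A B])
    fix y z assume y: "y \<in> ?A" and z: "z \<in> ?B"
    have "s * r \<le> s * coord_norm K z" using z s0 by (intro mult_left_mono) auto
    then have "d \<le> comb_norm q z - comb_norm q y" using y z by (simp add: d_def)
    also have "\<dots> \<le> sqrt (\<Sum>k\<in>K. (y k - z k)\<^sup>2)" by (rule lq_lipschitz[OF q])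
    finally have "d\<^sup>2 \<le> (sqrt (\<Sum>k\<in>K. (y k - z k)\<^sup>2))\<^sup>2"
      using d SM M2 by (intro power_mono) auto
    then show "d\<^sup>2 \<le> (\<Sum>k\<in>K. (y k - z k)\<^sup>2)" by (simp add: sum_nonneg)
  qed
  moreover have "1 / 2 * measure (gauss K) ?B \<le> measure (gauss K) ?A * measure (gauss K) ?B"
    using gauss_lq_median[OF q] by (intro mult_right_mono) (auto simp: M_def)
  ultimately have gB: "measure (gauss K) ?B \<le> 2 * exp (- d\<^sup>2 / 4)" by simp
  have p: "1 / 128 \<le> measure (gauss K) {z \<in> space (gauss K). r < coord_norm K z}"
  proof -
    have "coord_norm K z \<le> r \<longleftrightarrow> (\<Sum>k\<in>K. (z k)\<^sup>2) \<le> 3 / 4 * ?N" for z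
      by (simp add: coord_norm_def r_def)
    then have "measure (gauss K) {z \<in> space (gauss K). coord_norm K z \<le> r} \<le> 127 / 128"
      using gauss_small_ball[OF fin ne] by simp
    moreover have "measure (gauss K) {z \<in> space (gauss K). \<not> coord_norm K z \<le> r} =
        1 - measure (gauss K) {z \<in> space (gauss K). coord_norm K z \<le> r}"
      by (rule prob_neg) measurable
    ultimately show ?thesis by (simp add: not_le)
  qed
  have "measure ?V (?C \<inter> punctured_ball K) * (1 / 128) \<le>
      measure ?V (?C \<inter> punctured_ball K) * measure (gauss K) {z \<in> space (gauss K). r < coord_norm K z}"
    using p by (intro mult_left_mono) auto
  also have "\<dots> = measure (gauss K) ?B * measure ?V (punctured_ball K)"
    by (rule gauss_cone_outside_ball[OF fin C, symmetric]) (simp add: r_def)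
  also have "\<dots> \<le> 2 * exp (- d\<^sup>2 / 4) * measure ?V (punctured_ball K)"
    using gB by (intro mult_right_mono) auto
  finally have "measure ?V (?C \<inter> punctured_ball K) \<le> 4 * (64 * exp (- d\<^sup>2 / 4)) * measure ?V (punctured_ball K)"
    by simp
  also have "\<dots> \<le> 4 * exp (- (1 / 8) * s\<^sup>2 * ?N) * measure ?V (punctured_ball K)"
  proof (intro mult_right_mono mult_left_mono)
    \<comment> \<open>Since d^2/4 >= 4S^2/25 and 4/25 - 1/8 = 7/200, S >= 60 leaves at least 126,
      more than the 63 for which 1 + x <= exp x absorbs the factor 64.\<close>
    have "60\<^sup>2 \<le> S\<^sup>2" using SM M2 by (intro power_mono) auto
    moreover have "(4 / 5 * S)\<^sup>2 \<le> d\<^sup>2" using d SM M2 by (intro power_mono) auto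
    ultimately have "63 \<le> d\<^sup>2 / 4 - S\<^sup>2 / 8" by (simp add: power_mult_distrib power_divide)
    then have "64 \<le> exp (d\<^sup>2 / 4 - S\<^sup>2 / 8)" using exp_ge_add_one_self[of "d\<^sup>2 / 4 - S\<^sup>2 / 8"] by linarith
    then have "64 * exp (- d\<^sup>2 / 4) \<le> exp (d\<^sup>2 / 4 - S\<^sup>2 / 8) * exp (- d\<^sup>2 / 4)"
      by (rule mult_right_mono) simp
    also have "\<dots> = exp (- (1 / 8) * S\<^sup>2)" by (simp flip: exp_add)
    finally show "64 * exp (- d\<^sup>2 / 4) \<le> exp (- (1 / 8) * s\<^sup>2 * ?N)"
      by (simp add: S_def power_mult_distrib)
  qed auto
  finally show ?thesis .
qed

end

section \<open>Spectral subspaces\<close>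

lemma order_prod_linear:
  fixes e :: "'b \<Rightarrow> 'a::idom"
  assumes "finite A"
  shows "order x (\<Prod>k\<in>A. [:- e k, 1:]) = card {k \<in> A. e k = x}"
  using assms
proof (induction A rule: finite_induct)
  case (insert a A)
  have nz: "(\<Prod>k\<in>B. [:- e k, 1:]) \<noteq> 0" if "finite B" for B
    using that by (simp add: prod_zero_iff)
  have "order x (\<Prod>k\<in>insert a A. [:- e k, 1:]) = order x [:- e a, 1:] + card {k \<in> A. e k = x}"
    using insert nz[of "insert a A"] by (simp add: order_mult del: mult_pCons_left)
  also have "order x [:- e a, 1:] = (if e a = x then 1 else 0)"
    using order_linear_power[of x "e a" 0] order_0I[of "[:- e a, 1:]" x] order_power_n_n[of "e a" 1]
    by auto
  also have "\<dots> + card {k \<in> A. e k = x} = card {k \<in> insert a A. e k = x}"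
  proof (cases "e a = x")
    case True
    then have "{k \<in> insert a A. e k = x} = insert a {k \<in> A. e k = x}" by auto
    then show ?thesis using insert True by simp
  next
    case False
    then have "{k \<in> insert a A. e k = x} = {k \<in> A. e k = x}" by auto
    then show ?thesis using False by simp
  qed
  finally show ?case .
qed (simp add: order_0I)

text \<open>The matrix P with columns \<open>\<psi> k\<close> is orthogonal and H P = P D with D
  diagonal, so H is similar to D.\<close>

lemma char_poly_orthonormal_eigenbasis:
  assumes H: "H \<in> carrier_mat n n" and ob: "orthonormal_eigenbasis n H \<psi> ev"
  shows "char_poly H = (\<Prod>k<n. [:- ev k, 1:])"
proof -
  have car: "\<psi> k \<in> carrier_vec n" if "k < n" for k using ob that by (simp add: orthonormal_eigenbasis_def)
  have eig: "H *\<^sub>v \<psi> k = ev k \<cdot>\<^sub>v \<psi> k" if "k < n" for k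
    using ob that by (simp add: orthonormal_eigenbasis_def eigenvector_def)
  have orth: "\<psi> j \<bullet> \<psi> k = (if j = k then 1 else 0)" if "j < n" "k < n" for j k
    using ob that by (simp add: orthonormal_eigenbasis_def)
  define P where "P = mat n n (\<lambda>(i, k). \<psi> k $ i)"
  define D where "D = mat n n (\<lambda>(i, k). if i = k then ev k else 0)"
  have P: "P \<in> carrier_mat n n" and D: "D \<in> carrier_mat n n" by (auto simp: P_def D_def)
  have col: "col P k = \<psi> k" if "k < n" for k
    using that car[OF that] by (auto simp: P_def intro!: eq_vecI)
  have PtP: "transpose_mat P * P = 1\<^sub>m n"
    using P by (intro eq_matI) (auto simp: col orth)
  \<comment> \<open>Orthonormality gives a left inverse only; for square matrices it is also a right
    inverse.\<close>
  have PPt: "P * transpose_mat P = 1\<^sub>m n"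
    using mat_mult_left_right_inverse[OF _ P PtP] P by simp
  have HP: "H * P = P * D"
  proof (rule eq_matI)
    fix i k assume "i < dim_row (P * D)" "k < dim_col (P * D)"
    then have i: "i < n" and k: "k < n" using P D by auto
    have "(H * P) $$ (i, k) = (H *\<^sub>v \<psi> k) $ i" using H P i k by (simp add: col)
    also have "\<dots> = ev k * \<psi> k $ i" using eig[OF k] car[OF k] i by simp
    also have "\<dots> = (\<Sum>j<n. \<psi> j $ i * (if j = k then ev k else 0))"
      using k by (simp add: if_distrib cong: if_cong)
    also have "\<dots> = (P * D) $$ (i, k)"
      using P D i k by (simp add: scalar_prod_def P_def D_def atLeast0LessThan)
    finally show "(H * P) $$ (i, k) = (P * D) $$ (i, k)" .
  qed (use H P D in auto)
  have "H = H * (P * transpose_mat P)" using H PPt by simp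
  also have "\<dots> = P * D * transpose_mat P"
    using assoc_mult_mat[OF H P, of "transpose_mat P" n] P by (simp add: HP)
  finally have "similar_mat H D"
    unfolding similar_mat_def similar_mat_wit_def using H P D PPt PtP
    by (intro exI[of _ P] exI[of _ "transpose_mat P"]) (auto simp: Let_def)
  then have "char_poly H = char_poly D" by (rule char_poly_similar)
  also have "\<dots> = (\<Prod>a\<leftarrow>diag_mat D. [:- a, 1:])"
    using D by (rule char_poly_upper_triangular) (auto simp: D_def)
  also have "diag_mat D = map ev [0..<n]" by (auto simp: diag_mat_def D_def)
  also have "(\<Prod>a\<leftarrow>map ev [0..<n]. [:- a, 1:]) = (\<Prod>k<n. [:- ev k, 1:])"
    by (simp add: prod.list_conv_set_nth[symmetric] comp_def prod.distinct_set_conv_list[symmetric] atLeast0LessThan)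
  finally show ?thesis .
qed

text \<open>The theorem counts algebraic multiplicities while the sphere is built on basis indices;
  this identifies N(I) with the dimension of E_I.\<close>

lemma eig_count_eq_card:
  assumes H: "H \<in> carrier_mat n n" and ob: "orthonormal_eigenbasis n H \<psi> ev"
  shows "eig_count H I = card (eig_indices n ev I)"
proof -
  let ?K = "eig_indices n ev I"
  note cp = char_poly_orthonormal_eigenbasis[OF H ob]
  have "{x. eigenvalue H x \<and> x \<in> I} = ev ` ?K"
    by (auto simp: eigenvalue_root_char_poly[OF H] cp poly_prod prod_zero_iff eig_indices_def)
  then have "eig_count H I = (\<Sum>x\<in>ev ` ?K. card {k \<in> {..<n}. ev k = x})"
    by (simp add: eig_count_def cp order_prod_linear)
  also have "\<dots> = (\<Sum>x\<in>ev ` ?K. card {k \<in> ?K. ev k = x})"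
    by (intro sum.cong refl arg_cong[of _ _ card]) (auto simp: eig_indices_def)
  also have "\<dots> = (\<Sum>k\<in>?K. 1)"
    using sum.image_gen[of ?K "\<lambda>_. 1::nat" ev] by simp
  finally show ?thesis by simp
qed

section \<open>Transfer to the sphere, and the two tail bounds\<close>

lemma Lq_norm_eq_lq: "Lq_norm q u = lq q (dim_vec u) (\<lambda>i. u $ i)"
  by (simp add: Lq_norm_def lq_def)

lemma Linf_norm_le_Lq_norm:
  assumes q: "q > 0" and dim: "dim_vec u > 0"
  shows "Linf_norm u \<le> Lq_norm q u"
  unfolding Linf_norm_def
proof (rule Max.boundedI)
  fix a assume "a \<in> (\<lambda>i. \<bar>u $ i\<bar>) ` {..<dim_vec u}"
  then obtain i where i: "i < dim_vec u" "a = \<bar>u $ i\<bar>" by auto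
  have "\<bar>u $ i\<bar> powr q \<le> (\<Sum>i<dim_vec u. \<bar>u $ i\<bar> powr q)"
    using i by (intro member_le_sum) auto
  then have "(\<bar>u $ i\<bar> powr q) powr (1 / q) \<le> Lq_norm q u"
    unfolding Lq_norm_def using q by (intro powr_mono2) auto
  then show "a \<le> Lq_norm q u" using q i by (simp add: powr_powr)
qed (use dim in auto)

lemma sphere_lq_tail:
  assumes ob: "orthonormal_eigenbasis n H \<psi> ev" and ne: "eig_indices n ev I \<noteq> {}"
    and q: "q \<ge> 2" and s: "s \<ge> 60 * sqrt q * card (eig_indices n ev I) powr (1 / q - 1 / 2)"
  shows "measure (sphere_uniform n \<psi> ev I) {u \<in> spectral_sphere n \<psi> ev I. s \<le> Lq_norm q u}
    \<le> 4 * exp (- (1 / 8) * s\<^sup>2 * card (eig_indices n ev I))"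
proof -
  define K where "K = eig_indices n ev I"
  have fin: "finite K" and K: "K \<noteq> {}" using ne by (simp_all add: K_def)
  have car: "\<psi> k \<in> carrier_vec n" if "k \<in> K" for k
    using ob that by (auto simp: orthonormal_eigenbasis_def eig_indices_def K_def)
  have orth: "\<psi> j \<bullet> \<psi> k = (if j = k then 1 else 0)" if "j \<in> K" "k \<in> K" for j k
    using ob that by (auto simp: orthonormal_eigenbasis_def eig_indices_def K_def)
  have carc: "dim_vec (eig_comb n \<psi> K z) = n" for z
    by (rule carrier_vecD, rule eig_comb_carrier, rule car)
  interpret coordinate_isometry n K "\<lambda>k i. \<psi> k $ i"
  proof
    fix z :: "nat \<Rightarrow> real"
    have "(\<Sum>i<n. (\<Sum>k\<in>K. z k * \<psi> k $ i)\<^sup>2) = eig_comb n \<psi> K z \<bullet> eig_comb n \<psi> K z"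
      by (simp add: scalar_prod_def carc eig_comb_index[OF fin car] power2_eq_square atLeast0LessThan)
    also have "\<dots> = (\<Sum>k\<in>K. (z k)\<^sup>2)" by (rule eig_comb_norm[OF fin car orth])
    finally show "(\<Sum>i<n. (\<Sum>k\<in>K. z k * \<psi> k $ i)\<^sup>2) = (\<Sum>k\<in>K. (z k)\<^sup>2)" .
  qed (use fin K in auto)
  let ?S = "spectral_sphere n \<psi> ev I" and ?V = "\<Pi>\<^sub>M k\<in>K. (lborel :: real measure)"
  let ?T = "restrict_space (borel_vec n) ?S" and ?B = "punctured_ball K"
  let ?C = "{z \<in> K \<rightarrow>\<^sub>E UNIV. 0 < coord_norm K z \<and> s * coord_norm K z \<le> comb_norm q z}"
  let ?f = "\<lambda>z. eig_comb n \<psi> K (\<lambda>k. z k / coord_norm K z)"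
  let ?X = "{u \<in> ?S. s \<le> Lq_norm q u}"
  have f: "?f \<in> measurable (uniform_ball K) ?T"
    by (rule sphere_projection_measurable[OF ob K_def])
  have "?X = {u \<in> space ?T. s \<le> Lq_norm q u}"
    using sphere_subset_carrier[OF ob] by (auto simp: space_restrict_space space_borel_vec)
  also have "\<dots> \<in> sets ?T"
    by (intro borel_measurable_le borel_measurable_const measurable_restrict_space1 Lq_norm_measurable)
  finally have Xs: "?X \<in> sets ?T" .
  \<comment> \<open>By homogeneity of the norm, normalising a point of the punctured ball lands in
    the event exactly when the point lies in the cone.\<close>
  have pre: "?f -` ?X \<inter> space (uniform_ball K) = ?C \<inter> ?B"
  proof -
    have "?f z \<in> ?X \<longleftrightarrow> z \<in> ?C" if z: "z \<in> ?B" for z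
    proof -
      have pos: "0 < coord_norm K z" and zE: "z \<in> K \<rightarrow>\<^sub>E UNIV" using z by (auto simp: punctured_ball_def)
      have "?f z \<in> space ?T"
        using f z by (intro measurable_space[OF f]) (simp add: space_uniform_ball[OF fin])
      then have "?f z \<in> ?S" by (simp add: space_restrict_space)
      have "Lq_norm q (?f z) = lq q n (\<lambda>i. \<Sum>k\<in>K. z k / coord_norm K z * \<psi> k $ i)"
        unfolding Lq_norm_eq_lq lq_def carc by (simp add: eig_comb_index[OF fin car])
      also have "(\<lambda>i. \<Sum>k\<in>K. z k / coord_norm K z * \<psi> k $ i) = (\<lambda>i. (1 / coord_norm K z) * comb z i)"
        by (simp add: comb_def sum_distrib_left)
      also have "lq q n \<dots> = (1 / coord_norm K z) * comb_norm q z"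
        unfolding comb_norm_def using pos q by (intro lq_scale) auto
      also have "\<dots> = comb_norm q z / coord_norm K z" by simp
      finally have "s \<le> Lq_norm q (?f z) \<longleftrightarrow> s * coord_norm K z \<le> comb_norm q z"
        using pos by (simp only: pos_le_divide_eq)
      then show ?thesis using \<open>?f z \<in> ?S\<close> pos zE by simp
    qed
    then show ?thesis unfolding space_uniform_ball[OF fin] by blast
  qed
  have BV: "?B \<in> sets ?V" by (rule punctured_ball_sets[OF fin])
  have CV: "?C \<in> sets ?V" using cone_set_lq[of q s] q by (simp add: cone_set_def)
  note vol = emeasure_punctured_ball[OF fin K]
  have volpos: "measure ?V ?B > 0"
    using vol by (simp add: measure_def enn2real_positive_iff top.not_eq_extremum zero_less_iff_neq_zero)
  have "measure (sphere_uniform n \<psi> ev I) ?X = measure (uniform_ball K) (?C \<inter> ?B)"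
    unfolding sphere_uniform_def Let_def K_def[symmetric] measure_distr[OF f Xs] pre ..
  also have "\<dots> = measure (uniform_measure ?V ?B) (?C \<inter> ?B)"
    unfolding uniform_ball_def using BV by (intro measure_restrict_space) auto
  also have "\<dots> = measure ?V (?B \<inter> (?C \<inter> ?B)) / measure ?V ?B"
    using vol CV BV by (intro measure_uniform_measure) auto
  also have "?B \<inter> (?C \<inter> ?B) = ?C \<inter> ?B" by auto
  also have "measure ?V (?C \<inter> ?B) / measure ?V ?B \<le> 4 * exp (- (1 / 8) * s\<^sup>2 * card K)"
    using ball_lq_tail[OF q, of s] s volpos by (simp add: pos_divide_le_eq K_def)
  finally show ?thesis by (simp add: K_def)
qed

theorem theorem1p6:
  shows "\<exists>C::real. C > 0 \<and>
    (\<forall>(n::nat) (H::real mat) (I::real set) (\<psi>::nat \<Rightarrow> real vec) (ev::nat \<Rightarrow> real).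
       H \<in> carrier_mat n n \<longrightarrow> transpose_mat H = H \<longrightarrow> orthonormal_eigenbasis n H \<psi> ev \<longrightarrow>
       eig_count H I \<ge> 1 \<longrightarrow>
       (let N = real (eig_count H I); P = sphere_uniform n \<psi> ev I; S = spectral_sphere n \<psi> ev I in
         (\<forall>q \<Lambda>::real. q \<ge> 2 \<longrightarrow> \<Lambda> \<ge> 1 \<longrightarrow>
            measure P {u \<in> S. Lq_norm q u \<ge> C * \<Lambda> * sqrt q * N powr (1 / q - 1 / 2)}
              \<le> 4 * exp (- (1 / 8) * C\<^sup>2 * \<Lambda>\<^sup>2 * q * N powr (2 / q))) \<and>
         (\<forall>\<Lambda>::real. \<Lambda> \<ge> 1 \<longrightarrow>
            (let C' = C * exp 1 in
              measure P {u \<in> S. Linf_norm u \<ge> C' * \<Lambda> * (ln N / N) powr (1 / 2)}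
                \<le> 4 * N powr (- (1 / 8) * C'\<^sup>2 * \<Lambda>\<^sup>2)))))"
proof (intro exI[of _ 60] conjI allI impI)
  fix n H I \<psi> ev
  assume H: "H \<in> carrier_mat n n" and ob: "orthonormal_eigenbasis n H \<psi> ev" and c1: "eig_count H I \<ge> 1"
  define N where "N = real (eig_count H I)"
  define P where "P = sphere_uniform n \<psi> ev I"
  define S where "S = spectral_sphere n \<psi> ev I"
  have card: "card (eig_indices n ev I) = eig_count H I"
    using eig_count_eq_card[OF H ob] by simp
  have ne: "eig_indices n ev I \<noteq> {}" using c1 card by auto
  have N1: "N \<ge> 1" using c1 by (simp add: N_def)
  interpret P: prob_space P
    unfolding P_def by (rule prob_space_sphere_uniform[OF ob ne])
  have part1: "measure P {u \<in> S. 60 * \<Lambda> * sqrt q * N powr (1 / q - 1 / 2) \<le> Lq_norm q u}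
      \<le> 4 * exp (- (1 / 8) * 60\<^sup>2 * \<Lambda>\<^sup>2 * q * N powr (2 / q))" if q: "q \<ge> 2" and \<Lambda>: "\<Lambda> \<ge> 1" for q \<Lambda>
  proof -
    let ?s = "60 * \<Lambda> * sqrt q * N powr (1 / q - 1 / 2)"
    have "?s \<ge> 60 * sqrt q * N powr (1 / q - 1 / 2)"
      using \<Lambda> q by (intro mult_right_mono) auto
    then have "measure P {u \<in> S. ?s \<le> Lq_norm q u} \<le> 4 * exp (- (1 / 8) * ?s\<^sup>2 * N)"
      unfolding P_def S_def using sphere_lq_tail[OF ob ne q] by (simp add: card N_def)
    \<comment> \<open>The exponent of N is 2 (1/q - 1/2) + 1 = 2/q.\<close>
    also have "?s\<^sup>2 * N = 60\<^sup>2 * \<Lambda>\<^sup>2 * q * N powr (2 / q)"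
    proof -
      have "(N powr (1 / q - 1 / 2))\<^sup>2 * N = N powr ((1 / q - 1 / 2) + (1 / q - 1 / 2) + 1)"
        using N1 by (simp only: powr_add power2_eq_square powr_one)
      also have "(1 / q - 1 / 2) + (1 / q - 1 / 2) + 1 = 2 / q" by simp
      finally show ?thesis using q by (simp add: power_mult_distrib)
    qed
    then have "- (1 / 8) * ?s\<^sup>2 * N = - (1 / 8) * 60\<^sup>2 * \<Lambda>\<^sup>2 * q * N powr (2 / q)" by simp
    finally show ?thesis .
  qed
  have part2: "measure P {u \<in> S. 60 * exp 1 * \<Lambda> * (ln N / N) powr (1 / 2) \<le> Linf_norm u}
      \<le> 4 * N powr (- (1 / 8) * (60 * exp 1)\<^sup>2 * \<Lambda>\<^sup>2)" if \<Lambda>: "\<Lambda> \<ge> 1" for \<Lambda>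
  proof -
    let ?t = "60 * exp 1 * \<Lambda> * (ln N / N) powr (1 / 2)"
    have n0: "n > 0" using ne by (auto simp: eig_indices_def)
    have S: "dim_vec u = n" "Lq_norm 2 u \<le> 1" if "u \<in> S" for u
    proof -
      show dim: "dim_vec u = n"
        using sphere_subset_carrier[OF ob, of I] that unfolding S_def by (intro carrier_vecD) blast
      have "Lq_norm 2 u \<le> sqrt (\<Sum>i<n. (u $ i)\<^sup>2)"
        unfolding Lq_norm_eq_lq dim by (rule lq_le_l2) simp
      also have "\<dots> = sqrt (u \<bullet> u)"
        by (simp add: scalar_prod_def dim power2_eq_square atLeast0LessThan)
      finally show "Lq_norm 2 u \<le> 1" using that by (simp add: S_def spectral_sphere_def)
    qed
    \<comment> \<open>N is a natural number, so excluding 1 leaves N >= 2 and keeps ln N away from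
      0.\<close>
    consider "N = 1" | "ln N \<ge> 2" | "N \<ge> 2" "ln N < 2"
      using N1 by (fastforce simp: N_def)
    then show ?thesis
    proof cases
      \<comment> \<open>The right-hand side is 4 because 1 to any power is 1.\<close>
      case 1
      then show ?thesis using P.prob_le_1 by (simp add: order.trans[OF P.prob_le_1])
    next
      \<comment> \<open>With q = ln N one has N^(1/q) = e, which is where C' = C e comes from; ln N
        >= 2 makes this q admissible in (i).\<close>
      case 2
      then have N: "N > 1" using N1 by (cases "N = 1") auto
      have "sqrt (ln N) * N powr (1 / ln N - 1 / 2) = exp 1 * (ln N / N) powr (1 / 2)"
      proof -
        have "N powr (1 / ln N) = exp 1" using N by (simp add: powr_def)
        moreover have "(ln N / N) powr (1 / 2) = sqrt (ln N) / N powr (1 / 2)"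
          using N by (simp add: powr_divide powr_half_sqrt)
        ultimately show ?thesis by (simp add: powr_diff)
      qed
      then have t: "?t = 60 * \<Lambda> * sqrt (ln N) * N powr (1 / ln N - 1 / 2)" by simp
      have "measure P {u \<in> S. ?t \<le> Linf_norm u} \<le> measure P {u \<in> S. ?t \<le> Lq_norm (ln N) u}"
      proof (rule P.finite_measure_mono)
        show "{u \<in> S. ?t \<le> Linf_norm u} \<subseteq> {u \<in> S. ?t \<le> Lq_norm (ln N) u}"
          using Linf_norm_le_Lq_norm[of "ln N"] 2 S(1) n0 by (auto intro: order.trans)
        have "Lq_norm (ln N) \<in> borel_measurable (restrict_space (borel_vec n) (spectral_sphere n \<psi> ev I))"
          by (rule measurable_restrict_space1[OF Lq_norm_measurable])
        then have "Lq_norm (ln N) \<in> borel_measurable P"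
          unfolding P_def sphere_uniform_def Let_def by (simp only: measurable_distr_eq1)
        then have "{u \<in> space P. a \<le> Lq_norm (ln N) u} \<in> P.events" for a
          by (auto simp only: borel_measurable_iff_ge)
        then show "{u \<in> S. ?t \<le> Lq_norm (ln N) u} \<in> P.events"
          unfolding P_def S_def space_sphere_uniform[OF ob] .
      qed
      also have "\<dots> \<le> 4 * exp (- (1 / 8) * 60\<^sup>2 * \<Lambda>\<^sup>2 * ln N * N powr (2 / ln N))"
        unfolding t by (rule part1[OF 2 \<Lambda>])
      also have "N powr (2 / ln N) = (exp 1)\<^sup>2" using N by (simp add: powr_def flip: exp_double)
      also have "exp (- (1 / 8) * 60\<^sup>2 * \<Lambda>\<^sup>2 * ln N * (exp 1)\<^sup>2) = N powr (- (1 / 8) * (60 * exp 1)\<^sup>2 * \<Lambda>\<^sup>2)"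
        using N1 by (simp add: powr_def power_mult_distrib mult_ac)
      finally show ?thesis .
    next
      \<comment> \<open>Here 2 <= N <= 9 and ln N / N >= 1/18 > (1/6)^2, so the threshold is at
        least 60/6 = 10, whereas no coordinate of a unit vector exceeds 1 in absolute value.\<close>
      case 3
      have N8: "N \<le> 9"
      proof -
        have "N = exp (ln N)" using N1 by simp
        also have "\<dots> \<le> exp 2" unfolding exp_le_cancel_iff using 3 by linarith
        also have "\<dots> = (exp 1)\<^sup>2" by (simp flip: exp_double)
        also have "\<dots> \<le> 3\<^sup>2" using exp_le by (intro power_mono) auto
        finally show ?thesis by simp
      qed
      have "1 / 2 \<le> ln N"
      proof -
        have "1 / 2 \<le> ln (2::real)" using ln_ge_iff[of 2 "1/2"] exp_bound_half[of "1/2::real"] by simp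
        also have "\<dots> \<le> ln N" using 3 by simp
        finally show ?thesis .
      qed
      then have "(1 / 6)\<^sup>2 \<le> ln N / N" using N8 N1 by (simp add: power2_eq_square field_simps)
      then have "1 / 6 \<le> sqrt (ln N / N)" by (rule real_le_rsqrt)
      also have "\<dots> = (ln N / N) powr (1 / 2)"
        using N1 by (simp add: powr_half_sqrt)
      finally have "1 / 6 \<le> (ln N / N) powr (1 / 2)" .
      moreover have "60 \<le> 60 * exp 1 * \<Lambda>"
        using \<Lambda> mult_mono[of 1 "exp 1" 1 \<Lambda>] by simp
      ultimately have "60 * (1 / 6) \<le> ?t" using \<Lambda> by (intro mult_mono) auto
      then have "\<not> ?t \<le> Linf_norm u" if "u \<in> S" for u
      proof -
        have "Linf_norm u \<le> 1"
          using S[OF that] Linf_norm_le_Lq_norm[of 2 u] n0 by simp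
        then show ?thesis using \<open>60 * (1 / 6) \<le> ?t\<close> by linarith
      qed
      then have "{u \<in> S. ?t \<le> Linf_norm u} = {}" by blast
      then show ?thesis by (simp only: measure_empty) simp
    qed
  qed
  show "let N = real (eig_count H I); P = sphere_uniform n \<psi> ev I; S = spectral_sphere n \<psi> ev I in
         (\<forall>q \<Lambda>::real. q \<ge> 2 \<longrightarrow> \<Lambda> \<ge> 1 \<longrightarrow>
            measure P {u \<in> S. Lq_norm q u \<ge> 60 * \<Lambda> * sqrt q * N powr (1 / q - 1 / 2)}
              \<le> 4 * exp (- (1 / 8) * 60\<^sup>2 * \<Lambda>\<^sup>2 * q * N powr (2 / q))) \<and>
         (\<forall>\<Lambda>::real. \<Lambda> \<ge> 1 \<longrightarrow>
            (let C' = 60 * exp 1 in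
              measure P {u \<in> S. Linf_norm u \<ge> C' * \<Lambda> * (ln N / N) powr (1 / 2)}
                \<le> 4 * N powr (- (1 / 8) * C'\<^sup>2 * \<Lambda>\<^sup>2)))"
    unfolding Let_def using part1 part2 unfolding N_def P_def S_def by blast
qed simp

end
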